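(* (i) For every graphon $h\in\mathcal W$, the Laplacian operator $\mathcal L_h$ is a bounded operator on $L^2([0,1])$, and the map $h\mapsto\|\mathcal L_h\|$ is lower semi-continuous in the cut-metric $\delta_\square$. (ii) Let $G$ be a graph with $N$ vertices, let $h^G$ be the empirical graphon associated with $G$, and let $L_N$ be the Laplacian matrix of $G$, with spectral norm $\|L_N\|$. Then $$\frac{\|L_N\|}{N}=\|\mathcal L_{h^G}\|\qquad\text{for all }N.$$
   Context: $\mathcal W$ is the set of graphons: measurable $h\colon[0,1]^2\to[0,1]$ with $h(x,y)=h(y,x)$ for all $x,y$. $\mathcal M$ is the set of Lebesgue-measure-preserving bijections $\phi\colon[0,1]\to[0,1]$, and $h^\phi(x,y)=h(\phi(x),\phi(y))$. Cut-distance: $d_\square(h_1,h_2)=\sup_{S,T\subset[0,1]}\big|\int_{S\times T}[h_1-h_2]\,dx\,dy\big|$ (measurable $S,T$); cut-metric: $\delta_\square(h_1,h_2)=\inf_{\phi\in\mathcal M}d_\square(h_1,h_2^\phi)$. The Laplacian operator is $(\mathcal L_hu)(x)=\int_{[0,1]}h(x,y)[u(x)-u(y)]\,dy$, and $\|\mathcal L_h\|$ is its operator norm on $L^2([0,1])$. Graphs are finite and simple with vertex set $\{1,\dots,N\}$. The empirical graphon is $h^G(x,y)=1$ if there is an edge between vertices $\lceil Nx\rceil$ and $\lceil Ny\rceil$, and $h^G(x,y)=0$ otherwise. The Laplacian matrix is $L_N=D_N-A_N$, with $A_N$ the adjacency matrix and $D_N$ the diagonal matrix of degrees. *)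

theory Defs
  imports "HOL-Analysis.Analysis" "Jordan_Normal_Form.Matrix"
begin

abbreviation unit_leb :: "real measure" where
  "unit_leb \<equiv> lebesgue_on {0..1}"

text \<open>
  A graphon is represented by a function on all of the plane; only its values on the unit square
  are constrained, and only these values enter the notions below.
\<close>

definition graphons :: "(real \<Rightarrow> real \<Rightarrow> real) set" where
  "graphons = {h. (\<lambda>(x, y). h x y) \<in> borel_measurable (lebesgue_on ({0..1} \<times> {0..1})) \<and>
                  (\<forall>x\<in>{0..1}. \<forall>y\<in>{0..1}. h x y \<in> {0..1} \<and> h x y = h y x)}"

definition mp_bijections :: "(real \<Rightarrow> real) set" where
  "mp_bijections = {\<phi>. bij_betw \<phi> {0..1} {0..1} \<and>
                       \<phi> \<in> measurable unit_leb unit_leb \<and> distr unit_leb unit_leb \<phi> = unit_leb}"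

definition relabel :: "(real \<Rightarrow> real \<Rightarrow> real) \<Rightarrow> (real \<Rightarrow> real) \<Rightarrow> real \<Rightarrow> real \<Rightarrow> real" where
  "relabel h \<phi> = (\<lambda>x y. h (\<phi> x) (\<phi> y))"

definition cut_distance :: "(real \<Rightarrow> real \<Rightarrow> real) \<Rightarrow> (real \<Rightarrow> real \<Rightarrow> real) \<Rightarrow> real" where
  "cut_distance h1 h2 =
     (SUP (S, T) \<in> sets unit_leb \<times> sets unit_leb.
        \<bar>LINT p:S \<times> T|lebesgue. (case p of (x, y) \<Rightarrow> h1 x y - h2 x y)\<bar>)"

definition cut_metric :: "(real \<Rightarrow> real \<Rightarrow> real) \<Rightarrow> (real \<Rightarrow> real \<Rightarrow> real) \<Rightarrow> real" where
  "cut_metric h1 h2 = (INF \<phi> \<in> mp_bijections. cut_distance h1 (relabel h2 \<phi>))"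

text \<open>
  Lower semicontinuity for the topology of a pseudometric \<open>d\<close> on \<open>X\<close>.
\<close>

definition lower_semicontinuous_wrt ::
    "('a \<Rightarrow> 'a \<Rightarrow> real) \<Rightarrow> 'a set \<Rightarrow> ('a \<Rightarrow> real) \<Rightarrow> bool" where
  "lower_semicontinuous_wrt d X f \<longleftrightarrow>
     (\<forall>x\<in>X. \<forall>c < f x. \<exists>\<epsilon>>0. \<forall>y\<in>X. d y x < \<epsilon> \<longrightarrow> c < f y)"

text \<open>
  Elements of \<open>L\<^sup>2([0,1])\<close> are handled through representatives, equality being equality almost
  everywhere; \<open>bounded_operator_L2\<close> therefore demands that an operator respect this equality.
\<close>

definition L2_unit :: "(real \<Rightarrow> real) set" where
  "L2_unit = {u. u \<in> borel_measurable unit_leb \<and> integrable unit_leb (\<lambda>x. (u x)\<^sup>2)}"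

definition L2_unit_norm :: "(real \<Rightarrow> real) \<Rightarrow> real" where
  "L2_unit_norm u = sqrt (LINT x|unit_leb. (u x)\<^sup>2)"

definition bounded_operator_L2 :: "((real \<Rightarrow> real) \<Rightarrow> real \<Rightarrow> real) \<Rightarrow> bool" where
  "bounded_operator_L2 T \<longleftrightarrow>
     (\<forall>u\<in>L2_unit. T u \<in> L2_unit) \<and>
     (\<forall>u\<in>L2_unit. \<forall>v\<in>L2_unit. (AE x in unit_leb. u x = v x) \<longrightarrow> (AE x in unit_leb. T u x = T v x)) \<and>
     (\<forall>u\<in>L2_unit. \<forall>v\<in>L2_unit. AE x in unit_leb. T (\<lambda>z. u z + v z) x = T u x + T v x) \<and>
     (\<forall>u\<in>L2_unit. \<forall>c. AE x in unit_leb. T (\<lambda>z. c * u z) x = c * T u x) \<and>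
     (\<exists>C. \<forall>u\<in>L2_unit. L2_unit_norm (T u) \<le> C * L2_unit_norm u)"

definition opnorm_L2 :: "((real \<Rightarrow> real) \<Rightarrow> real \<Rightarrow> real) \<Rightarrow> real" where
  "opnorm_L2 T = (SUP u \<in> {u \<in> L2_unit. L2_unit_norm u \<le> 1}. L2_unit_norm (T u))"

definition laplacian_op :: "(real \<Rightarrow> real \<Rightarrow> real) \<Rightarrow> (real \<Rightarrow> real) \<Rightarrow> real \<Rightarrow> real" where
  "laplacian_op h u = (\<lambda>x. LINT y|unit_leb. h x y * (u x - u y))"

text \<open>
  Finite simple graphs on the vertex set \<open>{1..N}\<close>, given by their set of edges.
\<close>

definition simple_graph :: "nat \<Rightarrow> nat set set \<Rightarrow> bool" where
  "simple_graph N E \<longleftrightarrow> (\<forall>e\<in>E. e \<subseteq> {1..N} \<and> card e = 2)"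

definition empirical_graphon :: "nat \<Rightarrow> nat set set \<Rightarrow> real \<Rightarrow> real \<Rightarrow> real" where
  "empirical_graphon N E x y =
     (if {nat \<lceil>real N * x\<rceil>, nat \<lceil>real N * y\<rceil>} \<in> E then 1 else 0)"

text \<open>
  Matrix indices start at 0, so row and column \<open>i\<close> belong to the vertex \<open>Suc i\<close>.
\<close>

definition adjacency_matrix :: "nat \<Rightarrow> nat set set \<Rightarrow> real mat" where
  "adjacency_matrix N E = Matrix.mat N N (\<lambda>(i, j). if {Suc i, Suc j} \<in> E then 1 else 0)"

definition degree_matrix :: "nat \<Rightarrow> nat set set \<Rightarrow> real mat" where
  "degree_matrix N E = mat_diag N (\<lambda>i. real (card {e \<in> E. Suc i \<in> e}))"

definition laplacian_matrix :: "nat \<Rightarrow> nat set set \<Rightarrow> real mat" where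
  "laplacian_matrix N E = degree_matrix N E - adjacency_matrix N E"

definition euclidean_norm :: "real Matrix.vec \<Rightarrow> real" where
  "euclidean_norm v = sqrt (scalar_prod v v)"

definition spectral_norm :: "real mat \<Rightarrow> real" where
  "spectral_norm A =
     (SUP v \<in> {v \<in> carrier_vec (dim_col A). euclidean_norm v \<le> 1}. euclidean_norm (A *\<^sub>v v))"

end

(* Replacing a graphon h by an almost everywhere equal function g that is measurable for the product
   sigma-algebra reduces everything to Fubini's theorem for the bilinear form
     form u v = \<integral>\<integral> g(x,y) (u x - u y) v x = \<langle>L_h u, v\<rangle>.
   Lower semicontinuity: if c < ||L_h||, some simple functions u, v satisfy form u v > c ||u|| ||v||. For
   simple u, v the form is a linear combination of integrals of the kernel over rectangles S \<times> T,
   with coefficients depending only on the values of u and v. It is therefore Lipschitz in the cut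
   distance, with a constant that does not change when u, v are replaced by u o phi, v o phi, so the
   same inequality holds for every graphon that is close enough in the cut metric.
   Empirical graphons: step functions give ||L_N|| \<le> N ||L_h||. Conversely u splits into its
   cell averages, on which L_h acts as L_N / N, and a part of mean zero on each cell, on which L_h
   multiplies by the degrees d_i / N, where d_i \<le> ||L_N|| because d_i is an entry of L_N e_i. *)
theory Submission
  imports Defs
begin

subsection \<open>Lebesgue measure on the unit square\<close>

text \<open>The cylinder has product measure \<open>0\<close> times infinity, which is
  \<open>0\<close> in \<open>ennreal\<close>.\<close>

lemma null_sets_lborel_Times_UNIV:
  fixes N :: "'a::euclidean_space set"
  assumes "N \<in> null_sets lborel"
  shows "N \<times> (UNIV :: 'b::euclidean_space set) \<in> null_sets lborel"
    and "(UNIV :: 'b set) \<times> N \<in> null_sets lborel"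
proof -
  have "N \<times> (UNIV :: 'b set) \<in> null_sets (lborel \<Otimes>\<^sub>M lborel)"
    using assms by (auto simp: null_sets_def lborel.emeasure_pair_measure_Times)
  then show "N \<times> (UNIV :: 'b set) \<in> null_sets lborel"
    by (simp add: lborel_prod)
  have "(UNIV :: 'b set) \<times> N \<in> null_sets (lborel \<Otimes>\<^sub>M lborel)"
    using assms by (auto simp: null_sets_def lborel.emeasure_pair_measure_Times)
  then show "(UNIV :: 'b set) \<times> N \<in> null_sets lborel"
    by (simp add: lborel_prod)
qed

text \<open>A Lebesgue null set is covered by a Borel null set, and the cylinder over the latter is
  again Borel and null.\<close>

lemma AE_lebesgue_fst_snd:
  fixes P :: "'a::euclidean_space \<Rightarrow> bool"
  assumes "AE x in lebesgue. P x"
  shows "AE p in (lebesgue :: ('a \<times> 'b::euclidean_space) measure). P (fst p)"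
    and "AE p in (lebesgue :: ('b \<times> 'a) measure). P (snd p)"
proof -
  have "AE x in lborel. P x"
    using assms by (simp only: AE_completion_iff)
  then obtain N where N: "N \<in> null_sets lborel" "{x. \<not> P x} \<subseteq> N"
    by (auto simp: eventually_ae_filter)
  show "AE p in (lebesgue :: ('a \<times> 'b) measure). P (fst p)"
    using null_sets_lborel_Times_UNIV(1)[OF N(1)] N(2)
    by (intro AE_I'[OF null_sets_completionI]) auto
  show "AE p in (lebesgue :: ('b \<times> 'a) measure). P (snd p)"
    using null_sets_lborel_Times_UNIV(2)[OF N(1)] N(2)
    by (intro AE_I'[OF null_sets_completionI]) auto
qed

text \<open>The Borel main parts of \<open>A\<close> and \<open>B\<close> differ from them by null
  sets, so the two products agree almost everywhere. For the main parts the claim is the product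
  formula for \<open>lborel\<close>.\<close>

lemma lebesgue_Times:
  fixes A :: "'a::euclidean_space set" and B :: "'b::euclidean_space set"
  assumes A: "A \<in> sets lebesgue" and B: "B \<in> sets lebesgue"
  shows "A \<times> B \<in> sets lebesgue"
    and "emeasure lebesgue (A \<times> B) = emeasure lebesgue A * emeasure lebesgue B"
proof -
  define A' where "A' = main_part lborel A"
  define B' where "B' = main_part lborel B"
  have A': "A' \<in> sets borel" and B': "B' \<in> sets borel"
    using main_part_sets[OF A] main_part_sets[OF B] by (auto simp: A'_def B'_def)
  have mA: "emeasure lebesgue A = emeasure lborel A'" and mB: "emeasure lebesgue B = emeasure lborel B'"
    using A B by (auto simp: A'_def B'_def emeasure_completion)
  have aeA: "AE x in lebesgue. x \<in> A' \<longleftrightarrow> x \<in> A" and aeB: "AE x in lebesgue. x \<in> B' \<longleftrightarrow> x \<in> B"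
    using AE_in_main_part[OF A, THEN AE_completion] AE_in_main_part[OF B, THEN AE_completion]
    by (simp_all only: A'_def B'_def)
  have ae: "AE p in (lebesgue :: ('a \<times> 'b) measure). p \<in> A' \<times> B' \<longleftrightarrow> p \<in> A \<times> B"
    using AE_lebesgue_fst_snd(1)[OF aeA] AE_lebesgue_fst_snd(2)[OF aeB]
    by eventually_elim auto
  have AB': "A' \<times> B' \<in> sets borel"
    using A' B' by (simp add: borel_Times)
  then have *: "A' \<times> B' \<in> sets lebesgue"
    by auto
  show AB: "A \<times> B \<in> sets lebesgue"
    by (rule completion.in_sets_AE[OF ae *]) auto
  have "emeasure lebesgue (A \<times> B) = emeasure lebesgue (A' \<times> B')"
    using ae AB * by (intro emeasure_eq_AE) auto
  also have "\<dots> = emeasure (lborel \<Otimes>\<^sub>M lborel) (A' \<times> B')"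
    using AB' by (simp add: lborel_prod)
  also have "\<dots> = emeasure lborel A' * emeasure lborel B'"
    using A' B' by (simp add: lborel.emeasure_pair_measure_Times)
  finally show "emeasure lebesgue (A \<times> B) = emeasure lebesgue A * emeasure lebesgue B"
    by (simp add: mA mB)
qed

text \<open>Completeness of Lebesgue measure. It makes integrands containing \<open>h\<close>
  measurable by comparison with a measurable representative.\<close>

lemma measurable_AE_eq:
  fixes f g :: "'a::euclidean_space \<Rightarrow> 'b::euclidean_space"
  assumes f: "f \<in> borel_measurable (lebesgue_on S)" and S: "S \<in> sets lebesgue"
    and ae: "AE x in lebesgue_on S. f x = g x"
  shows "g \<in> borel_measurable (lebesgue_on S)"
proof -
  have "(\<lambda>x. if x \<in> S then f x else 0) \<in> borel_measurable lebesgue"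
    using f S by (simp add: borel_measurable_if)
  moreover have "AE x in lebesgue. (if x \<in> S then f x else 0) = (if x \<in> S then g x else 0)"
    using ae S by (auto simp: AE_restrict_space_iff)
  ultimately have "(\<lambda>x. if x \<in> S then g x else 0) \<in> borel_measurable lebesgue"
    by (rule borel_measurable_AE)
  then show ?thesis
    using S by (simp add: borel_measurable_if)
qed

abbreviation unit_square :: "(real \<times> real) set" where
  "unit_square \<equiv> {0..1} \<times> {0..1}"

abbreviation square_leb :: "(real \<times> real) measure" where
  "square_leb \<equiv> unit_leb \<Otimes>\<^sub>M unit_leb"

interpretation unit_leb: finite_measure unit_leb
  by (rule finite_measure_lebesgue_on) auto

interpretation square_leb: pair_sigma_finite unit_leb unit_leb ..

lemma emeasure_unit_leb [simp]: "emeasure unit_leb {0..1} = 1" "measure unit_leb {0..1} = 1"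
  by (auto simp: emeasure_restrict_space measure_restrict_space)

lemma space_square_leb [simp]: "space square_leb = unit_square"
  by (simp add: space_pair_measure)

lemma unit_square_lebesgue [measurable]: "unit_square \<in> sets lebesgue"
  by (intro lebesgue_Times) auto

text \<open>Graphons are measured by the complete measure \<open>lebesgue_on unit_square\<close>,
  while Fubini's theorem speaks of the product \<open>square_leb\<close>. The two agree on
  rectangles, so the identity map carries the former to the latter.\<close>

lemma square_leb_eq_distr: "square_leb = distr (lebesgue_on unit_square) square_leb (\<lambda>p. p)"
  and measurable_square_leb_id: "(\<lambda>p. p) \<in> measurable (lebesgue_on unit_square) square_leb"
proof -
  have Times: "A \<times> B \<in> sets (lebesgue_on unit_square)
      \<and> emeasure (lebesgue_on unit_square) (A \<times> B) = emeasure unit_leb A * emeasure unit_leb B"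
    if "A \<in> sets unit_leb" "B \<in> sets unit_leb" for A B
  proof -
    have A: "A \<subseteq> {0..1}" "A \<in> sets lebesgue" and B: "B \<subseteq> {0..1}" "B \<in> sets lebesgue"
      using that by (auto simp: sets_restrict_space_iff)
    have AB: "A \<times> B \<subseteq> unit_square"
      using A B by blast
    show ?thesis
      using AB A B lebesgue_Times[OF A(2) B(2)]
      by (auto simp: sets_restrict_space_iff emeasure_restrict_space)
  qed
  show id: "(\<lambda>p. p) \<in> measurable (lebesgue_on unit_square) square_leb"
  proof (rule measurable_sigma_sets[OF sets_pair_measure])
    show "{a \<times> b |a b. a \<in> sets unit_leb \<and> b \<in> sets unit_leb} \<subseteq> Pow (space unit_leb \<times> space unit_leb)"
      by (rule pair_measure_closed)
    show "(\<lambda>p. p) \<in> space (lebesgue_on unit_square) \<rightarrow> space unit_leb \<times> space unit_leb"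
      by auto
    show "(\<lambda>p. p) -` y \<inter> space (lebesgue_on unit_square) \<in> sets (lebesgue_on unit_square)"
      if "y \<in> {a \<times> b |a b. a \<in> sets unit_leb \<and> b \<in> sets unit_leb}" for y
      using that Times by (auto intro!: sets.Int)
  qed
  show "square_leb = distr (lebesgue_on unit_square) square_leb (\<lambda>p. p)"
  proof (rule pair_measure_eqI)
    fix A B assume AB: "A \<in> sets unit_leb" "B \<in> sets unit_leb"
    have "A \<times> B \<subseteq> unit_square"
      using AB[THEN sets.sets_into_space] by auto
    with AB show "emeasure unit_leb A * emeasure unit_leb B
        = emeasure (distr (lebesgue_on unit_square) square_leb (\<lambda>p. p)) (A \<times> B)"
      using Times[OF AB] AB id by (simp add: emeasure_distr Int_absorb2)
  qed (auto intro: unit_leb.sigma_finite_measure_axioms)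
qed

lemma measurable_square_leb_borel: "(\<lambda>p. p) \<in> measurable square_leb (borel \<Otimes>\<^sub>M borel)"
proof -
  have id: "(\<lambda>x. x) \<in> borel_measurable unit_leb"
    by (intro measurable_restrict_space1 measurable_completion) simp
  have "(\<lambda>p. (fst p, snd p)) \<in> measurable square_leb (borel \<Otimes>\<^sub>M borel)"
    by (intro measurable_Pair measurable_compose[OF measurable_fst id] measurable_compose[OF measurable_snd id])
  then show ?thesis
    by simp
qed

text \<open>A null set of the completion need not lie in the product sigma-algebra. It is therefore
  enlarged to a Borel null set, whose trace on the square does.\<close>

lemma AE_square_lebI:
  assumes "AE p in lebesgue_on unit_square. P p"
  shows "AE p in square_leb. P p"
proof -
  have "AE p in lebesgue. p \<in> unit_square \<longrightarrow> P p"
    using assms by (subst (asm) AE_restrict_space_iff) auto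
  then have "AE p in lborel. p \<in> unit_square \<longrightarrow> P p"
    by (simp only: AE_completion_iff)
  then obtain N where N: "N \<in> null_sets lborel" "{p. p \<in> unit_square \<and> \<not> P p} \<subseteq> N"
    by (auto simp: eventually_ae_filter)
  have "N \<in> sets (borel \<Otimes>\<^sub>M borel)"
    using N(1) unfolding borel_prod by auto
  with measurable_square_leb_borel have "(\<lambda>p. p) -` N \<inter> space square_leb \<in> sets square_leb"
    by (rule measurable_sets)
  then have sN: "N \<inter> unit_square \<in> sets square_leb"
    by simp
  have "N \<in> null_sets lebesgue"
    using N(1) by (rule null_sets_completionI)
  then have "N \<inter> unit_square \<in> null_sets (lebesgue_on unit_square)"
    by (auto simp: null_sets_restrict_space intro: null_set_Int2)
  then have "emeasure (lebesgue_on unit_square) (N \<inter> unit_square) = 0"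
    by (rule null_setsD1)
  then have "emeasure square_leb (N \<inter> unit_square) = 0"
    by (subst square_leb_eq_distr) (simp add: emeasure_distr measurable_square_leb_id sN Int_absorb2)
  then show ?thesis
    using N(2) sN by (intro AE_I[of _ _ "N \<inter> unit_square"]) auto
qed

lemma AE_square_lebD:
  assumes "AE p in square_leb. P p"
  shows "AE p in lebesgue_on unit_square. P p"
  using assms by (subst (asm) square_leb_eq_distr) (rule AE_distrD[OF measurable_square_leb_id])

lemma integral_square_leb:
  fixes f :: "real \<times> real \<Rightarrow> real"
  assumes "f \<in> borel_measurable square_leb"
  shows "(LINT p|lebesgue_on unit_square. f p) = (LINT p|square_leb. f p)"
  using integral_distr[OF measurable_square_leb_id assms]
  by (simp only: square_leb_eq_distr[symmetric])

subsection \<open>The Laplacian of a graphon on $L^2$\<close>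

text \<open>\<open>h\<close> itself is only Lebesgue measurable on the square; \<open>g\<close> is a
  version of it to which Fubini's theorem applies directly. Its bounds hold at every point, which
  keeps exceptional sets out of the estimates.\<close>

locale kernel_representative =
  fixes g :: "real \<times> real \<Rightarrow> real" and h :: "real \<Rightarrow> real \<Rightarrow> real"
  assumes measurable_g [measurable]: "g \<in> borel_measurable square_leb"
    and g_nonneg: "0 \<le> g p" and g_le_1: "g p \<le> 1"
    and AE_eq: "AE p in square_leb. h (fst p) (snd p) = g p"

lemma graphon_kernel_representative:
  assumes "h \<in> graphons"
  obtains g where "kernel_representative g h"
proof -
  have h: "(\<lambda>(x, y). h x y) \<in> borel_measurable (lebesgue_on unit_square)"
    and h01: "\<And>x y. x \<in> {0..1} \<Longrightarrow> y \<in> {0..1} \<Longrightarrow> h x y \<in> {0..1}"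
    using assms by (auto simp: graphons_def)
  have "(\<lambda>p. if p \<in> unit_square then (\<lambda>(x, y). h x y) p else 0) \<in> borel_measurable lebesgue"
    using h by (subst borel_measurable_if) auto
  then obtain g where g: "g \<in> borel_measurable lborel"
    and eq: "AE p in lborel. (if p \<in> unit_square then (\<lambda>(x, y). h x y) p else 0) = g p"
    using completion_ex_borel_measurable_real by blast
  \<comment> \<open>Truncation enforces the bounds everywhere and changes nothing at points of the
    square where \<open>g\<close> agrees with \<open>h\<close>.\<close>
  define g' where "g' p = max 0 (min 1 (g p))" for p
  have [measurable]: "g \<in> borel_measurable (borel \<Otimes>\<^sub>M borel)"
    using g by (simp add: borel_prod)
  have "g' \<in> borel_measurable (borel \<Otimes>\<^sub>M borel)"
    unfolding g'_def by measurable
  from measurable_compose[OF measurable_square_leb_borel this]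
  have g': "g' \<in> borel_measurable square_leb" .
  have "AE p in lebesgue. p \<in> unit_square \<longrightarrow> h (fst p) (snd p) = g' p"
    using AE_completion[OF eq]
  proof eventually_elim
    case (elim p)
    then show ?case
      using h01[of "fst p" "snd p"] by (auto simp: g'_def)
  qed
  then have "AE p in lebesgue_on unit_square. h (fst p) (snd p) = g' p"
    by (subst AE_restrict_space_iff) auto
  then have "AE p in square_leb. h (fst p) (snd p) = g' p"
    by (rule AE_square_lebI)
  with g' have "kernel_representative g' h"
    by unfold_locales (auto simp: g'_def)
  then show thesis ..
qed

section \<open>Square integrable functions on the unit interval\<close>

lemma square_sum_le: "(a + b)\<^sup>2 \<le> 2 * a\<^sup>2 + 2 * b\<^sup>2" for a b :: real
  using zero_le_power2[of "a - b"] by (simp add: power2_eq_square algebra_simps)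

lemma abs_mult_le_square_sum: "\<bar>a * b\<bar> \<le> a\<^sup>2 + b\<^sup>2" for a b :: real
proof -
  have "2 * \<bar>a * b\<bar> \<le> a\<^sup>2 + b\<^sup>2"
    using zero_le_power2[of "\<bar>a\<bar> - \<bar>b\<bar>"] by (simp add: power2_eq_square algebra_simps abs_mult)
  then show ?thesis
    by linarith
qed

lemma L2_unit_measurable [measurable_dest]: "u \<in> L2_unit \<Longrightarrow> u \<in> borel_measurable unit_leb"
  by (simp add: L2_unit_def)

lemma L2_unit_square_integrable: "u \<in> L2_unit \<Longrightarrow> integrable unit_leb (\<lambda>x. (u x)\<^sup>2)"
  by (simp add: L2_unit_def)

lemma L2_unit_norm_nonneg: "0 \<le> L2_unit_norm u"
  by (simp add: L2_unit_norm_def)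

lemma L2_unit_norm_square: "(L2_unit_norm u)\<^sup>2 = (LINT x|unit_leb. (u x)\<^sup>2)"
  by (simp add: L2_unit_norm_def integral_nonneg_AE)

lemma L2_unit_mult_integrable:
  assumes "u \<in> L2_unit" "v \<in> L2_unit"
  shows "integrable unit_leb (\<lambda>x. u x * v x)"
proof (rule Bochner_Integration.integrable_bound)
  show "integrable unit_leb (\<lambda>x. (u x)\<^sup>2 + (v x)\<^sup>2)"
    using assms by (intro Bochner_Integration.integrable_add L2_unit_square_integrable)
  show "(\<lambda>x. u x * v x) \<in> borel_measurable unit_leb"
    using assms[THEN L2_unit_measurable] by measurable
  show "AE x in unit_leb. norm (u x * v x) \<le> norm ((u x)\<^sup>2 + (v x)\<^sup>2)"
    using abs_mult_le_square_sum by auto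
qed

lemma L2_unit_const: "(\<lambda>_. c) \<in> L2_unit"
  by (simp add: L2_unit_def)

lemma L2_unit_integrable: "u \<in> L2_unit \<Longrightarrow> integrable unit_leb u"
  using L2_unit_mult_integrable[OF _ L2_unit_const[of 1], of u] by simp

lemma L2_unit_cmult: "u \<in> L2_unit \<Longrightarrow> (\<lambda>x. c * u x) \<in> L2_unit"
  by (auto simp: L2_unit_def power_mult_distrib)

lemma L2_unit_add:
  assumes "u \<in> L2_unit" "v \<in> L2_unit"
  shows "(\<lambda>x. u x + v x) \<in> L2_unit"
  using assms L2_unit_mult_integrable[OF assms]
  by (auto simp: L2_unit_def power2_sum mult.assoc)

lemma L2_unit_norm_cmult: "L2_unit_norm (\<lambda>x. c * u x) = \<bar>c\<bar> * L2_unit_norm u"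
  by (simp add: L2_unit_norm_def power_mult_distrib real_sqrt_mult)

lemma L2_unit_norm_cong_AE:
  assumes "AE x in unit_leb. u x = v x" "u \<in> borel_measurable unit_leb" "v \<in> borel_measurable unit_leb"
  shows "L2_unit_norm u = L2_unit_norm v"
  unfolding L2_unit_norm_def
  using assms by (intro arg_cong[where f=sqrt] integral_cong_AE) auto

text \<open>The integral of \<open>(s * u x - t * v x)\<^sup>2\<close> is nonnegative for all
  \<open>s\<close> and \<open>t\<close>; suitable values give the bound.\<close>

lemma L2_unit_Cauchy_Schwarz:
  assumes u: "u \<in> L2_unit" and v: "v \<in> L2_unit"
  shows "(LINT x|unit_leb. u x * v x) \<le> L2_unit_norm u * L2_unit_norm v"
proof -
  let ?a = "L2_unit_norm u" and ?b = "L2_unit_norm v" and ?i = "LINT x|unit_leb. u x * v x"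
  note int = u[THEN L2_unit_square_integrable] v[THEN L2_unit_square_integrable]
    L2_unit_mult_integrable[OF u v]
  have *: "0 \<le> s\<^sup>2 * ?a\<^sup>2 - 2 * (s * t) * ?i + t\<^sup>2 * ?b\<^sup>2" for s t
  proof -
    have "0 \<le> (LINT x|unit_leb. (s * u x - t * v x)\<^sup>2)"
      by simp
    also have "\<dots> = (LINT x|unit_leb. s\<^sup>2 * (u x)\<^sup>2 - 2 * (s * t) * (u x * v x) + t\<^sup>2 * (v x)\<^sup>2)"
      by (intro Bochner_Integration.integral_cong) (auto simp: power2_eq_square algebra_simps)
    also have "\<dots> = s\<^sup>2 * ?a\<^sup>2 - 2 * (s * t) * ?i + t\<^sup>2 * ?b\<^sup>2"
      using int by (simp add: L2_unit_norm_square)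
    finally show ?thesis .
  qed
  show ?thesis
  proof (cases "?a = 0 \<or> ?b = 0")
    case True
    have "?i \<le> 0"
    proof (rule ccontr)
      assume i: "\<not> ?i \<le> 0"
      from True show False
      proof
        assume "?a = 0"
        \<comment> \<open>With \<open>?a = 0\<close> the quadratic is affine in \<open>s\<close>.
          This choice of \<open>s\<close> gives it the value \<open>- ?b\<^sup>2 - 2\<close>, which
          is negative.\<close>
        with *[of "(?b\<^sup>2 + 1) / ?i" 1] i have "2 \<le> - ?b\<^sup>2"
          by (simp add: divide_simps)
        then show False
          using zero_le_power2[of ?b] by linarith
      next
        assume "?b = 0"
        with *[of 1 "(?a\<^sup>2 + 1) / ?i"] i have "2 \<le> - ?a\<^sup>2"
          by (simp add: divide_simps)
        then show False
          using zero_le_power2[of ?a] by linarith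
      qed
    qed
    with True show ?thesis
      by auto
  next
    case False
    then have pos: "0 < ?a" "0 < ?b"
      using L2_unit_norm_nonneg by (auto simp: less_le)
    \<comment> \<open>The values \<open>s = ?b\<close> and \<open>t = ?a\<close> make both square
      terms equal to the square of \<open>?a * ?b\<close>.\<close>
    from *[of ?b ?a] have "(?a * ?b) * ?i \<le> (?a * ?b) * (?a * ?b)"
      by (simp add: power2_eq_square algebra_simps)
    with pos show ?thesis
      by (simp add: mult_le_cancel_left)
  qed
qed

lemma integrable_square_leb_fst_snd:
  fixes f :: "real \<Rightarrow> real"
  assumes f: "integrable unit_leb f"
  shows "integrable square_leb (\<lambda>p. f (fst p))" "integrable square_leb (\<lambda>p. f (snd p))"
proof -
  have [measurable]: "f \<in> borel_measurable unit_leb"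
    using f by auto
  show "integrable square_leb (\<lambda>p. f (fst p))"
    by (rule square_leb.Fubini_integrable) (use f in auto)
  show "integrable square_leb (\<lambda>p. f (snd p))"
    by (rule square_leb.Fubini_integrable) (use f in auto)
qed

lemma integrable_square_leb_L2_mult:
  assumes u: "u \<in> L2_unit" and v: "v \<in> L2_unit"
  shows "integrable square_leb (\<lambda>p. u (snd p) * v (fst p))"
proof (rule Bochner_Integration.integrable_bound)
  show "integrable square_leb (\<lambda>p. (u (snd p))\<^sup>2 + (v (fst p))\<^sup>2)"
    using u v by (intro Bochner_Integration.integrable_add integrable_square_leb_fst_snd L2_unit_square_integrable)
  show "(\<lambda>p. u (snd p) * v (fst p)) \<in> borel_measurable square_leb"
    using assms[THEN L2_unit_measurable] by measurable
  show "AE p in square_leb. norm (u (snd p) * v (fst p)) \<le> norm ((u (snd p))\<^sup>2 + (v (fst p))\<^sup>2)"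
    using abs_mult_le_square_sum by auto
qed

section \<open>Boundedness of the Laplacian and its bilinear form\<close>

context kernel_representative
begin

lemma measurable_g_section [measurable]: "x \<in> {0..1} \<Longrightarrow> (\<lambda>y. g (x, y)) \<in> borel_measurable unit_leb"
  by measurable

definition rep_op :: "(real \<Rightarrow> real) \<Rightarrow> real \<Rightarrow> real" where
  "rep_op u x = (LINT y|unit_leb. g (x, y) * (u x - u y))"

lemma measurable_rep_op [measurable]:
  assumes [measurable]: "u \<in> borel_measurable unit_leb"
  shows "rep_op u \<in> borel_measurable unit_leb"
  unfolding rep_op_def by measurable

text \<open>By Fubini's theorem for null sets, for almost every \<open>x\<close> the sections of
  \<open>h\<close> and \<open>g\<close> at \<open>x\<close> agree almost everywhere, so the two
  integrals over \<open>y\<close> coincide.\<close>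

lemma laplacian_eq_rep_op:
  assumes [measurable]: "u \<in> borel_measurable unit_leb"
  shows "AE x in unit_leb. laplacian_op h u x = rep_op u x"
  using square_leb.AE_pair[OF AE_eq] AE_space
proof eventually_elim
  case (elim x)
  then have x: "x \<in> {0..1}" and ae: "AE y in unit_leb. h x y = g (x, y)"
    by auto
  have *: "(\<lambda>y. g (x, y) * (u x - u y)) \<in> borel_measurable unit_leb"
    using x by measurable
  have ae': "AE y in unit_leb. g (x, y) * (u x - u y) = h x y * (u x - u y)"
    using ae by eventually_elim simp
  have "(\<lambda>y. h x y * (u x - u y)) \<in> borel_measurable unit_leb"
    by (rule measurable_AE_eq[OF * _ ae']) auto
  with * ae' show ?case
    unfolding laplacian_op_def rep_op_def by (intro integral_cong_AE) auto
qed

lemma measurable_laplacian: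
  assumes "u \<in> borel_measurable unit_leb"
  shows "laplacian_op h u \<in> borel_measurable unit_leb"
  by (rule measurable_AE_eq[OF measurable_rep_op[OF assms]])
    (use laplacian_eq_rep_op[OF assms] in \<open>auto elim: AE_mp\<close>)

lemma abs_g_mult_le: "\<bar>g p * a\<bar> \<le> \<bar>a\<bar>"
  using mult_right_mono[OF g_le_1[of p], of "\<bar>a\<bar>"] by (simp add: abs_mult g_nonneg)

text \<open>On a space of mass one the square of an integral is at most the integral of the square.
  The integrand is bounded by \<open>\<bar>u x - u y\<bar>\<close>, and \<open>square_sum_le\<close>
  separates the variables.\<close>

lemma rep_op_square_le:
  assumes u: "u \<in> L2_unit" and x: "x \<in> {0..1}"
  shows "integrable unit_leb (\<lambda>y. g (x, y) * (u x - u y))"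
    and "(rep_op u x)\<^sup>2 \<le> 2 * (u x)\<^sup>2 + 2 * (L2_unit_norm u)\<^sup>2"
proof -
  let ?f = "\<lambda>y. g (x, y) * (u x - u y)"
  have [measurable]: "u \<in> borel_measurable unit_leb"
    using u by (rule L2_unit_measurable)
  have f [measurable]: "?f \<in> borel_measurable unit_leb"
    using x by measurable
  have int: "integrable unit_leb (\<lambda>y. 2 * (u x)\<^sup>2 + 2 * (u y)\<^sup>2)"
    using L2_unit_square_integrable[OF u] by simp
  have le: "(?f y)\<^sup>2 \<le> 2 * (u x)\<^sup>2 + 2 * (u y)\<^sup>2" for y
  proof -
    have "(?f y)\<^sup>2 \<le> (u x - u y)\<^sup>2"
      using abs_g_mult_le by (simp add: abs_le_square_iff)
    also have "\<dots> \<le> 2 * (u x)\<^sup>2 + 2 * (u y)\<^sup>2"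
      using square_sum_le[of "u x" "- u y"] by simp
    finally show ?thesis .
  qed
  have int_f2: "integrable unit_leb (\<lambda>y. (?f y)\<^sup>2)"
    by (rule Bochner_Integration.integrable_bound[OF int borel_measurable_power[OF f]]) (use le in simp)
  then have f_L2: "?f \<in> L2_unit"
    using f by (simp add: L2_unit_def)
  then show "integrable unit_leb ?f"
    by (rule L2_unit_integrable)
  have norm_one: "L2_unit_norm (\<lambda>_. c) = \<bar>c\<bar>" for c
    by (simp add: L2_unit_norm_def)
  \<comment> \<open>Cauchy-Schwarz is stated without absolute value, so it is applied to both
    constants \<open>1\<close> and \<open>-1\<close>.\<close>
  have "\<bar>rep_op u x\<bar> \<le> L2_unit_norm ?f"
    using L2_unit_Cauchy_Schwarz[OF f_L2 L2_unit_const[of 1]] L2_unit_Cauchy_Schwarz[OF f_L2 L2_unit_const[of "-1"]]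
    by (simp add: norm_one rep_op_def)
  then have "(rep_op u x)\<^sup>2 \<le> (L2_unit_norm ?f)\<^sup>2"
    by (metis abs_le_square_iff abs_of_nonneg L2_unit_norm_nonneg)
  also have "\<dots> \<le> (LINT y|unit_leb. 2 * (u x)\<^sup>2 + 2 * (u y)\<^sup>2)"
    unfolding L2_unit_norm_square using int_f2 int le by (intro integral_mono) auto
  also have "\<dots> = 2 * (u x)\<^sup>2 + 2 * (L2_unit_norm u)\<^sup>2"
    using L2_unit_square_integrable[OF u] by (simp add: L2_unit_norm_square)
  finally show "(rep_op u x)\<^sup>2 \<le> 2 * (u x)\<^sup>2 + 2 * (L2_unit_norm u)\<^sup>2" .
qed

text \<open>Integrating the pointwise bound over an interval of length one gives four times the
  squared norm, hence the constant \<open>2\<close>.\<close>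

lemma rep_op_L2:
  assumes u: "u \<in> L2_unit"
  shows "rep_op u \<in> L2_unit" and "L2_unit_norm (rep_op u) \<le> 2 * L2_unit_norm u"
proof -
  have [measurable]: "u \<in> borel_measurable unit_leb"
    using u by (rule L2_unit_measurable)
  have int: "integrable unit_leb (\<lambda>x. 2 * (u x)\<^sup>2 + 2 * (L2_unit_norm u)\<^sup>2)"
    using L2_unit_square_integrable[OF u] by simp
  have int2: "integrable unit_leb (\<lambda>x. (rep_op u x)\<^sup>2)"
    by (rule Bochner_Integration.integrable_bound[OF int]) (use rep_op_square_le(2)[OF u] in auto)
  then show "rep_op u \<in> L2_unit"
    by (simp add: L2_unit_def)
  have "(L2_unit_norm (rep_op u))\<^sup>2 \<le> (LINT x|unit_leb. 2 * (u x)\<^sup>2 + 2 * (L2_unit_norm u)\<^sup>2)"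
    unfolding L2_unit_norm_square[of "rep_op u"]
    using int int2 rep_op_square_le(2)[OF u] by (intro integral_mono) auto
  also have "\<dots> = (2 * L2_unit_norm u)\<^sup>2"
    using L2_unit_square_integrable[OF u] by (simp add: L2_unit_norm_square power_mult_distrib)
  finally show "L2_unit_norm (rep_op u) \<le> 2 * L2_unit_norm u"
    by (rule power2_le_imp_le) (simp add: L2_unit_norm_nonneg)
qed

lemma laplacian_L2:
  assumes u: "u \<in> L2_unit"
  shows "laplacian_op h u \<in> L2_unit"
    and "L2_unit_norm (laplacian_op h u) = L2_unit_norm (rep_op u)"
proof -
  note [measurable] = u[THEN L2_unit_measurable]
  note m = measurable_laplacian[OF u[THEN L2_unit_measurable]]
  note ae = laplacian_eq_rep_op[OF u[THEN L2_unit_measurable]]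
  show "L2_unit_norm (laplacian_op h u) = L2_unit_norm (rep_op u)"
    using ae m by (intro L2_unit_norm_cong_AE) auto
  have "AE x in unit_leb. (rep_op u x)\<^sup>2 = (laplacian_op h u x)\<^sup>2"
    using ae by eventually_elim simp
  then have "integrable unit_leb (\<lambda>x. (laplacian_op h u x)\<^sup>2)"
    using m L2_unit_square_integrable[OF rep_op_L2(1)[OF u]]
    by (subst integrable_cong_AE[of _ _ "\<lambda>x. (rep_op u x)\<^sup>2"]) (auto elim: AE_mp)
  with m show "laplacian_op h u \<in> L2_unit"
    by (simp add: L2_unit_def)
qed

lemma bounded_operator_laplacian: "bounded_operator_L2 (laplacian_op h)"
  unfolding bounded_operator_L2_def
proof (intro conjI ballI allI impI)
  show "laplacian_op h u \<in> L2_unit" if "u \<in> L2_unit" for u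
    using that by (rule laplacian_L2)
  show "\<exists>C. \<forall>u\<in>L2_unit. L2_unit_norm (laplacian_op h u) \<le> C * L2_unit_norm u"
    using laplacian_L2(2) rep_op_L2(2) by auto
  show "AE x in unit_leb. laplacian_op h u x = laplacian_op h v x"
    if u: "u \<in> L2_unit" and v: "v \<in> L2_unit" and eq: "AE x in unit_leb. u x = v x" for u v
    using laplacian_eq_rep_op[OF u[THEN L2_unit_measurable]]
      laplacian_eq_rep_op[OF v[THEN L2_unit_measurable]] eq AE_space
  proof eventually_elim
    case (elim x)
    then have "x \<in> {0..1}" by simp
    have "AE y in unit_leb. g (x, y) * (u x - u y) = g (x, y) * (v x - v y)"
      using eq by eventually_elim (use elim in simp)
    then have "rep_op u x = rep_op v x"
      unfolding rep_op_def
      using rep_op_square_le(1)[OF u \<open>x \<in> {0..1}\<close>] rep_op_square_le(1)[OF v \<open>x \<in> {0..1}\<close>]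
      by (intro integral_cong_AE) auto
    with elim show ?case by simp
  qed
  show "AE x in unit_leb. laplacian_op h (\<lambda>z. u z + v z) x = laplacian_op h u x + laplacian_op h v x"
    if u: "u \<in> L2_unit" and v: "v \<in> L2_unit" for u v
    using laplacian_eq_rep_op[OF u[THEN L2_unit_measurable]]
      laplacian_eq_rep_op[OF v[THEN L2_unit_measurable]]
      laplacian_eq_rep_op[OF L2_unit_add[OF u v, THEN L2_unit_measurable]] AE_space
  proof eventually_elim
    case (elim x)
    then have "x \<in> {0..1}" by simp
    have "rep_op (\<lambda>z. u z + v z) x = (LINT y|unit_leb. g (x, y) * (u x - u y) + g (x, y) * (v x - v y))"
      unfolding rep_op_def by (intro Bochner_Integration.integral_cong) (auto simp: algebra_simps)
    also have "\<dots> = rep_op u x + rep_op v x"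
      unfolding rep_op_def
      using rep_op_square_le(1)[OF u \<open>x \<in> {0..1}\<close>] rep_op_square_le(1)[OF v \<open>x \<in> {0..1}\<close>]
      by (rule Bochner_Integration.integral_add)
    finally show ?case using elim by simp
  qed
  show "AE x in unit_leb. laplacian_op h (\<lambda>z. c * u z) x = c * laplacian_op h u x"
    if u: "u \<in> L2_unit" for u c
  proof -
    have "laplacian_op h (\<lambda>z. c * u z) x = (LINT y|unit_leb. c * (h x y * (u x - u y)))" for x
      unfolding laplacian_op_def by (intro Bochner_Integration.integral_cong) (auto simp: algebra_simps)
    \<comment> \<open>The constant leaves the integral at every \<open>x\<close>: where the
      integrand is not integrable, the default value \<open>0\<close> makes both sides zero.\<close>
    then show ?thesis
      by (simp add: laplacian_op_def)
  qed
qed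

lemma integrable_form:
  assumes u: "u \<in> L2_unit" and v: "v \<in> L2_unit"
  shows "integrable square_leb (\<lambda>p. (u (fst p) - u (snd p)) * v (fst p))"
    and "integrable square_leb (\<lambda>p. g p * ((u (fst p) - u (snd p)) * v (fst p)))"
proof -
  note [measurable] = u[THEN L2_unit_measurable] v[THEN L2_unit_measurable]
  show *: "integrable square_leb (\<lambda>p. (u (fst p) - u (snd p)) * v (fst p))"
    using integrable_square_leb_fst_snd(1)[OF L2_unit_mult_integrable[OF u v]]
      integrable_square_leb_L2_mult[OF u v]
    by (simp add: left_diff_distrib)
  show "integrable square_leb (\<lambda>p. g p * ((u (fst p) - u (snd p)) * v (fst p)))"
    by (rule Bochner_Integration.integrable_bound[OF *]) (use abs_g_mult_le in auto)
qed

text \<open>Fubini's theorem: integrating over \<open>y\<close> first produces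
  \<open>rep_op u x\<close>. Bounds on the form thus become bounds on the operator.\<close>

lemma form_eq:
  assumes u: "u \<in> L2_unit" and v: "v \<in> L2_unit"
  shows "(LINT p|square_leb. g p * ((u (fst p) - u (snd p)) * v (fst p))) = (LINT x|unit_leb. rep_op u x * v x)"
  using square_leb.integral_fst'[OF integrable_form(2)[OF u v]]
  by (simp add: rep_op_def flip: mult.assoc)

end

text \<open>A real supremum is meaningful only over a bounded set, so boundedness comes first. The
  last claim follows by normalising \<open>u\<close>.\<close>

lemma opnorm_L2_properties:
  assumes T: "bounded_operator_L2 T"
  shows "bdd_above ((\<lambda>u. L2_unit_norm (T u)) ` {u \<in> L2_unit. L2_unit_norm u \<le> 1})"
    and "0 \<le> opnorm_L2 T"
    and "u \<in> L2_unit \<Longrightarrow> L2_unit_norm (T u) \<le> opnorm_L2 T * L2_unit_norm u"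
proof -
  obtain C where C: "\<And>u. u \<in> L2_unit \<Longrightarrow> L2_unit_norm (T u) \<le> C * L2_unit_norm u"
    using T unfolding bounded_operator_L2_def by blast
  show bdd: "bdd_above ((\<lambda>u. L2_unit_norm (T u)) ` {u \<in> L2_unit. L2_unit_norm u \<le> 1})"
  proof (rule bdd_aboveI2)
    fix u assume "u \<in> {u \<in> L2_unit. L2_unit_norm u \<le> 1}"
    then have u: "u \<in> L2_unit" and le: "L2_unit_norm u \<le> 1"
      by auto
    note C[OF u]
    \<comment> \<open>The constant supplied by boundedness may be negative, hence the absolute
      value.\<close>
    also have "C * L2_unit_norm u \<le> \<bar>C\<bar> * 1"
      using le by (intro mult_mono) (auto simp: L2_unit_norm_nonneg)
    finally show "L2_unit_norm (T u) \<le> \<bar>C\<bar>"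
      by simp
  qed
  have upper: "L2_unit_norm (T u) \<le> opnorm_L2 T" if "u \<in> L2_unit" "L2_unit_norm u \<le> 1" for u
    unfolding opnorm_L2_def using that by (intro cSUP_upper bdd) auto
  have "L2_unit_norm (\<lambda>_. 0) \<le> 1"
    by (simp add: L2_unit_norm_def)
  from upper[OF L2_unit_const this] show "0 \<le> opnorm_L2 T"
    using L2_unit_norm_nonneg order_trans by blast
  show "L2_unit_norm (T u) \<le> opnorm_L2 T * L2_unit_norm u" if u: "u \<in> L2_unit"
  proof (cases "L2_unit_norm u = 0")
    \<comment> \<open>Normalising is impossible here, but the bound with \<open>C\<close> forces the
      norm of \<open>T u\<close> to vanish.\<close>
    case True
    with C[OF u] show ?thesis by simp
  next
    case False
    define c where "c = inverse (L2_unit_norm u)"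
    have c: "0 < c" "c * L2_unit_norm u = 1"
      using False L2_unit_norm_nonneg[of u] by (auto simp: c_def less_le)
    have "AE x in unit_leb. T (\<lambda>z. c * u z) x = c * T u x"
      and Tu: "T (\<lambda>z. c * u z) \<in> L2_unit" "T u \<in> L2_unit"
      using T u L2_unit_cmult[OF u] by (auto simp: bounded_operator_L2_def)
    then have "L2_unit_norm (T (\<lambda>z. c * u z)) = L2_unit_norm (\<lambda>x. c * T u x)"
      using L2_unit_cmult[OF Tu(2)]
      by (intro L2_unit_norm_cong_AE) (auto dest: L2_unit_measurable)
    then have "c * L2_unit_norm (T u) = L2_unit_norm (T (\<lambda>z. c * u z))"
      using c by (simp add: L2_unit_norm_cmult)
    also have "\<dots> \<le> opnorm_L2 T"
      using c by (intro upper L2_unit_cmult u) (simp add: L2_unit_norm_cmult)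
    finally have "c * L2_unit_norm (T u) * L2_unit_norm u \<le> opnorm_L2 T * L2_unit_norm u"
      by (rule mult_right_mono) (rule L2_unit_norm_nonneg)
    moreover have "c * L2_unit_norm (T u) * L2_unit_norm u = L2_unit_norm (T u)"
      using c(2) by (metis mult.commute mult.left_commute mult.right_neutral)
    ultimately show ?thesis by simp
  qed
qed

subsection \<open>Lower semicontinuity\<close>

text \<open>Applying \<open>\<phi>\<close> in both coordinates preserves the product measure, so the
  almost everywhere equality and integrals can be pulled back along it.\<close>

lemma relabel_kernel_representative:
  assumes "kernel_representative g h" and "\<phi> \<in> mp_bijections"
  shows "kernel_representative (\<lambda>p. g (\<phi> (fst p), \<phi> (snd p))) (relabel h \<phi>)"
    and "\<And>f :: real \<times> real \<Rightarrow> real. f \<in> borel_measurable square_leb \<Longrightarrow>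
      (LINT p|square_leb. f (\<phi> (fst p), \<phi> (snd p))) = (LINT p|square_leb. f p)"
proof -
  interpret kernel_representative g h by fact
  have [measurable]: "\<phi> \<in> measurable unit_leb unit_leb" and distr: "distr unit_leb unit_leb \<phi> = unit_leb"
    using assms(2) by (auto simp: mp_bijections_def)
  have m: "(\<lambda>p. (\<phi> (fst p), \<phi> (snd p))) \<in> measurable square_leb square_leb"
    by measurable
  have eq: "distr square_leb square_leb (\<lambda>p. (\<phi> (fst p), \<phi> (snd p))) = square_leb"
    using pair_measure_distr[of \<phi> unit_leb unit_leb \<phi> unit_leb unit_leb] unit_leb.sigma_finite_measure_axioms
    by (simp add: distr case_prod_beta')
  have "AE p in square_leb. h (fst (\<phi> (fst p), \<phi> (snd p))) (snd (\<phi> (fst p), \<phi> (snd p)))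
      = g (\<phi> (fst p), \<phi> (snd p))"
    by (rule AE_distrD[OF m]) (simp only: eq AE_eq)
  then show "kernel_representative (\<lambda>p. g (\<phi> (fst p), \<phi> (snd p))) (relabel h \<phi>)"
    using measurable_compose[OF m measurable_g]
    by unfold_locales (auto simp: g_nonneg g_le_1 relabel_def)
  fix f :: "real \<times> real \<Rightarrow> real"
  assume "f \<in> borel_measurable square_leb"
  from integral_distr[OF m this]
  show "(LINT p|square_leb. f (\<phi> (fst p), \<phi> (snd p))) = (LINT p|square_leb. f p)"
    by (simp only: eq)
qed

lemma id_mp_bijections: "(\<lambda>x. x) \<in> mp_bijections"
  by (auto simp: mp_bijections_def bij_betw_def distr_id)

lemma mp_bijections_L2:
  assumes "u \<in> L2_unit" "\<phi> \<in> mp_bijections"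
  shows "(\<lambda>x. u (\<phi> x)) \<in> L2_unit" and "L2_unit_norm (\<lambda>x. u (\<phi> x)) = L2_unit_norm u"
proof -
  have m: "\<phi> \<in> measurable unit_leb unit_leb" and distr: "distr unit_leb unit_leb \<phi> = unit_leb"
    using assms(2) by (auto simp: mp_bijections_def)
  have u: "u \<in> borel_measurable unit_leb" "integrable unit_leb (\<lambda>x. (u x)\<^sup>2)"
    using assms(1) by (auto simp: L2_unit_def)
  from integrable_distr[OF m, of "\<lambda>x. (u x)\<^sup>2"] u(2) measurable_compose[OF m u(1)]
  show "(\<lambda>x. u (\<phi> x)) \<in> L2_unit"
    by (simp add: L2_unit_def distr)
  have "(\<lambda>x. (u x)\<^sup>2) \<in> borel_measurable unit_leb"
    using u(1) by measurable
  from integral_distr[OF m this]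
  show "L2_unit_norm (\<lambda>x. u (\<phi> x)) = L2_unit_norm u"
    by (simp add: L2_unit_norm_def distr)
qed

text \<open>Passing to \<open>g1\<close> and \<open>g2\<close> moves the integral in
  \<open>cut_distance\<close> to the product measure. The bound by one shows that the supremum there
  is taken over a bounded set.\<close>

lemma cut_distance_integral:
  assumes "kernel_representative g1 h1" "kernel_representative g2 h2"
    and S: "S \<in> sets unit_leb" and T: "T \<in> sets unit_leb"
  shows "(LINT p:S \<times> T|lebesgue. (case p of (x, y) \<Rightarrow> h1 x y - h2 x y)) =
    (LINT p|square_leb. (g1 p - g2 p) * (indicator S (fst p) * indicator T (snd p)))" (is "?l = ?r")
    and "\<bar>LINT p|square_leb. (g1 p - g2 p) * (indicator S (fst p) * indicator T (snd p))\<bar> \<le> 1"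
proof -
  interpret k1: kernel_representative g1 h1 by fact
  interpret k2: kernel_representative g2 h2 by fact
  let ?F = "\<lambda>p. (g1 p - g2 p) * (indicator S (fst p) * indicator T (snd p))"
  let ?f = "\<lambda>p. indicator (S \<times> T) p * (h1 (fst p) (snd p) - h2 (fst p) (snd p))"
  have [measurable]: "S \<in> sets unit_leb" "T \<in> sets unit_leb"
    using S T .
  have F [measurable]: "?F \<in> borel_measurable square_leb"
    by measurable
  have F': "?F \<in> borel_measurable (lebesgue_on unit_square)"
    using measurable_compose[OF measurable_square_leb_id F] .
  have sub: "S \<times> T \<subseteq> unit_square"
    using sets.sets_into_space[OF S] sets.sets_into_space[OF T] by auto
  have "AE p in square_leb. ?F p = ?f p"
    using k1.AE_eq k2.AE_eq by eventually_elim (auto simp: indicator_def)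
  then have ae: "AE p in lebesgue_on unit_square. ?F p = ?f p"
    by (rule AE_square_lebD)
  have f: "?f \<in> borel_measurable (lebesgue_on unit_square)"
    by (rule measurable_AE_eq[OF F' _ ae]) auto
  have "?l = (LINT p|lebesgue. indicator unit_square p *\<^sub>R ?f p)"
    unfolding set_lebesgue_integral_def
    using sub by (intro Bochner_Integration.integral_cong) (auto simp: indicator_def)
  also have "\<dots> = (LINT p|lebesgue_on unit_square. ?f p)"
    by (rule integral_restrict_space[symmetric]) auto
  also have "\<dots> = (LINT p|lebesgue_on unit_square. ?F p)"
    using ae f F' by (intro integral_cong_AE) auto
  also have "\<dots> = ?r"
    by (rule integral_square_leb) (rule F)
  finally show "?l = ?r" .
  have int1: "integrable square_leb (\<lambda>p. 1 :: real)"
    using integrable_square_leb_fst_snd(1)[of "\<lambda>_. 1"] by simp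
  have "\<bar>g1 p - g2 p\<bar> \<le> 1" for p
    using k1.g_nonneg[of p] k2.g_nonneg[of p] k1.g_le_1[of p] k2.g_le_1[of p] by linarith
  then have le: "\<bar>?F p\<bar> \<le> 1" for p
    by (auto simp: indicator_def)
  have intF: "integrable square_leb ?F"
    by (rule Bochner_Integration.integrable_bound[OF int1 F]) (use le in auto)
  have "\<bar>?r\<bar> \<le> (LINT p|square_leb. \<bar>?F p\<bar>)"
    by (rule integral_abs_bound)
  also have "\<dots> \<le> (LINT p|square_leb. 1)"
    using intF int1 le by (intro integral_mono) auto
  also have "\<dots> = 1"
    by (simp add: measure_def unit_leb.emeasure_pair_measure_Times)
  finally show "\<bar>?r\<bar> \<le> 1" .
qed

lemma cut_distance_upper:
  assumes k: "kernel_representative g1 h1" "kernel_representative g2 h2"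
    and ST: "S \<in> sets unit_leb" "T \<in> sets unit_leb"
  shows "\<bar>LINT p|square_leb. (g1 p - g2 p) * (indicator S (fst p) * indicator T (snd p))\<bar> \<le> cut_distance h1 h2"
proof -
  let ?I = "\<lambda>(S, T). \<bar>LINT p:S \<times> T|lebesgue. (case p of (x, y) \<Rightarrow> h1 x y - h2 x y)\<bar>"
  have "bdd_above (?I ` (sets unit_leb \<times> sets unit_leb))"
    by (rule bdd_aboveI2[of _ _ 1]) (use cut_distance_integral[OF k] in auto)
  from cSUP_upper[OF _ this, of "(S, T)"] ST cut_distance_integral(1)[OF k ST] show ?thesis
    by (simp add: cut_distance_def)
qed

text \<open>A triple \<open>(a, b, c)\<close> records the values of \<open>u x\<close>,
  \<open>v x\<close> and \<open>u y\<close>. The points with given values form a rectangle, on which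
  the test factor is the constant \<open>(a - c) * b\<close>; each rectangle costs at most one cut
  distance. The bound involves \<open>u\<close> and \<open>v\<close> only through
  \<open>A\<close>.\<close>

lemma simple_form_cut_distance_le:
  assumes k: "kernel_representative g1 h1" "kernel_representative g2 h2"
    and [measurable]: "u \<in> borel_measurable unit_leb" "v \<in> borel_measurable unit_leb"
    and A: "finite A" "u ` {0..1} \<subseteq> A" "v ` {0..1} \<subseteq> A"
  shows "\<bar>LINT p|square_leb. (g1 p - g2 p) * ((u (fst p) - u (snd p)) * v (fst p))\<bar>
    \<le> (\<Sum>(a, b, c)\<in>A \<times> A \<times> A. \<bar>(a - c) * b\<bar>) * cut_distance h1 h2"
proof -
  interpret k1: kernel_representative g1 h1 by fact
  interpret k2: kernel_representative g2 h2 by fact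
  define I where "I = A \<times> A \<times> A"
  define w where "w = (\<lambda>(a, b, c). (a - c) * b :: real)"
  define S where "S i = {x \<in> space unit_leb. u x = fst i \<and> v x = fst (snd i)}" for i :: "real \<times> real \<times> real"
  define T where "T i = {x \<in> space unit_leb. u x = snd (snd i)}" for i :: "real \<times> real \<times> real"
  have ST [measurable]: "S i \<in> sets unit_leb" "T i \<in> sets unit_leb" for i
    unfolding S_def T_def by measurable
  let ?D = "\<lambda>i p. (g1 p - g2 p) * (indicator (S i) (fst p) * indicator (T i) (snd p))"
  have "finite I"
    using A by (simp add: I_def)
  have int1: "integrable square_leb (\<lambda>p. 1 :: real)"
    using integrable_square_leb_fst_snd(1)[of "\<lambda>_. 1"] by simp
  have bound: "\<bar>g1 p - g2 p\<bar> \<le> 1" for p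
    using k1.g_nonneg[of p] k2.g_nonneg[of p] k1.g_le_1[of p] k2.g_le_1[of p] by linarith
  have intD: "integrable square_leb (?D i)" for i
    by (rule Bochner_Integration.integrable_bound[OF int1]) (use bound in \<open>auto simp: indicator_def\<close>)
  have expand: "(g1 p - g2 p) * ((u (fst p) - u (snd p)) * v (fst p)) = (\<Sum>i\<in>I. w i * ?D i p)"
    if p: "p \<in> space square_leb" for p
  proof -
    \<comment> \<open>The rectangles are disjoint and cover the square: exactly the one indexed by
      the values at \<open>p\<close> contributes.\<close>
    let ?i = "(u (fst p), v (fst p), u (snd p))"
    have "(\<Sum>i\<in>I. w i * ?D i p) = (\<Sum>i\<in>I. if i = ?i then w i * (g1 p - g2 p) else 0)"
      using p by (intro sum.cong) (auto simp: S_def T_def indicator_def)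
    also have "\<dots> = w ?i * (g1 p - g2 p)"
      using \<open>finite I\<close> p A by (subst sum.delta) (auto simp: I_def)
    finally show ?thesis
      by (simp add: w_def)
  qed
  have "(LINT p|square_leb. (g1 p - g2 p) * ((u (fst p) - u (snd p)) * v (fst p)))
      = (LINT p|square_leb. (\<Sum>i\<in>I. w i * ?D i p))"
    using expand by (intro Bochner_Integration.integral_cong) auto
  also have "\<dots> = (\<Sum>i\<in>I. w i * (LINT p|square_leb. ?D i p))"
    using intD by (subst Bochner_Integration.integral_sum) auto
  also have "\<bar>\<dots>\<bar> \<le> (\<Sum>i\<in>I. \<bar>w i\<bar> * cut_distance h1 h2)"
    by (rule order_trans[OF sum_abs])
      (auto simp: abs_mult intro!: sum_mono mult_left_mono cut_distance_upper[OF k ST])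
  finally show ?thesis
    by (simp add: I_def w_def sum_distrib_right case_prod_beta')
qed

section \<open>Approximation by simple functions\<close>

lemma L2_unit_simple_dominated:
  assumes u: "u \<in> L2_unit" and s: "simple_function unit_leb s"
    and le: "\<And>x. x \<in> {0..1} \<Longrightarrow> \<bar>s x\<bar> \<le> 2 * \<bar>u x\<bar>"
  shows "s \<in> L2_unit"
proof -
  have s' [measurable]: "s \<in> borel_measurable unit_leb"
    using s by (rule borel_measurable_simple_function)
  have int: "integrable unit_leb (\<lambda>x. 4 * (u x)\<^sup>2)"
    using L2_unit_square_integrable[OF u] by simp
  have "(s x)\<^sup>2 \<le> 4 * (u x)\<^sup>2" if "x \<in> {0..1}" for x
    using power_mono[OF le[OF that], of 2] by (simp add: power_mult_distrib)
  then have "integrable unit_leb (\<lambda>x. (s x)\<^sup>2)"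
    by (intro Bochner_Integration.integrable_bound[OF int]) auto
  with s' show ?thesis
    by (simp add: L2_unit_def)
qed

lemma L2_unit_simple_approximation:
  assumes u: "u \<in> L2_unit"
  obtains s where "\<And>i. simple_function unit_leb (s i)" "\<And>i. s i \<in> L2_unit"
    "\<And>x. x \<in> {0..1} \<Longrightarrow> (\<lambda>i. s i x) \<longlonglongrightarrow> u x"
    "\<And>i x. x \<in> {0..1} \<Longrightarrow> \<bar>s i x\<bar> \<le> 2 * \<bar>u x\<bar>"
    "(\<lambda>i. L2_unit_norm (s i)) \<longlonglongrightarrow> L2_unit_norm u"
proof -
  have um: "u \<in> borel_measurable unit_leb"
    using u by (rule L2_unit_measurable)
  \<comment> \<open>With base point \<open>0\<close>, the distance bound of the library lemma
    becomes domination by \<open>2 * \<bar>u x\<bar>\<close>; its square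
    \<open>4 * (u x)\<^sup>2\<close> dominates below.\<close>
  obtain s where "\<forall>i. simple_function unit_leb (s i)" "\<forall>x\<in>{0..1}. (\<lambda>i. s i x) \<longlonglongrightarrow> u x"
    "\<forall>i. \<forall>x\<in>{0..1}. \<bar>s i x\<bar> \<le> 2 * \<bar>u x\<bar>"
    using borel_measurable_implies_sequence_metric[OF um, of 0] by (auto simp: dist_real_def)
  then have s: "\<And>i. simple_function unit_leb (s i)"
    and lim: "\<And>x. x \<in> {0..1} \<Longrightarrow> (\<lambda>i. s i x) \<longlonglongrightarrow> u x"
    and le: "\<And>i x. x \<in> {0..1} \<Longrightarrow> \<bar>s i x\<bar> \<le> 2 * \<bar>u x\<bar>"
    by blast+
  have L2: "s i \<in> L2_unit" for i
    using L2_unit_simple_dominated[OF u s le] .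
  have int: "integrable unit_leb (\<lambda>x. 4 * (u x)\<^sup>2)"
    using L2_unit_square_integrable[OF u] by simp
  have le2: "(s i x)\<^sup>2 \<le> 4 * (u x)\<^sup>2" if "x \<in> {0..1}" for x i
    using power_mono[OF le[OF that, of i], of 2] by (simp add: power_mult_distrib)
  have "(\<lambda>i. LINT x|unit_leb. (s i x)\<^sup>2) \<longlonglongrightarrow> (LINT x|unit_leb. (u x)\<^sup>2)"
  proof (rule integral_dominated_convergence[OF _ _ int])
    show "(\<lambda>x. (u x)\<^sup>2) \<in> borel_measurable unit_leb"
      using um by measurable
    show "(\<lambda>x. (s i x)\<^sup>2) \<in> borel_measurable unit_leb" for i
      using L2_unit_measurable[OF L2] by measurable
    show "AE x in unit_leb. (\<lambda>i. (s i x)\<^sup>2) \<longlonglongrightarrow> (u x)\<^sup>2"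
      using lim by (auto intro!: AE_I2 tendsto_power)
    show "AE x in unit_leb. norm ((s i x)\<^sup>2) \<le> 4 * (u x)\<^sup>2" for i
      using le2 by (auto intro!: AE_I2)
  qed
  then have "(\<lambda>i. L2_unit_norm (s i)) \<longlonglongrightarrow> L2_unit_norm u"
    unfolding L2_unit_norm_def by (rule tendsto_real_sqrt)
  with s L2 lim le show thesis
    by (rule that)
qed

context kernel_representative
begin

abbreviation form :: "(real \<Rightarrow> real) \<Rightarrow> (real \<Rightarrow> real) \<Rightarrow> real" where
  "form u v \<equiv> LINT p|square_leb. g p * ((u (fst p) - u (snd p)) * v (fst p))"

text \<open>For \<open>w = rep_op u\<close> the form at \<open>u\<close>, \<open>w\<close> is the
  squared norm of \<open>w\<close>, which exceeds \<open>c\<close> times the product of the norms of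
  \<open>u\<close> and \<open>w\<close>. The inequality is strict, so it survives for simple
  approximations that are far enough along the sequences.\<close>

lemma simple_test_functions:
  assumes u: "u \<in> L2_unit" and u1: "L2_unit_norm u \<le> 1" and c: "0 \<le> c" "c < L2_unit_norm (rep_op u)"
  obtains s t where "simple_function unit_leb s" "simple_function unit_leb t" "s \<in> L2_unit" "t \<in> L2_unit"
    "c * (L2_unit_norm s * L2_unit_norm t) < form s t"
proof -
  define w where "w = rep_op u"
  have w: "w \<in> L2_unit"
    unfolding w_def using u by (rule rep_op_L2)
  obtain s where s: "\<And>i. simple_function unit_leb (s i)" "\<And>i. s i \<in> L2_unit"
    "\<And>x. x \<in> {0..1} \<Longrightarrow> (\<lambda>i. s i x) \<longlonglongrightarrow> u x"
    "\<And>i x. x \<in> {0..1} \<Longrightarrow> \<bar>s i x\<bar> \<le> 2 * \<bar>u x\<bar>"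
    "(\<lambda>i. L2_unit_norm (s i)) \<longlonglongrightarrow> L2_unit_norm u"
    using L2_unit_simple_approximation[OF u] by blast
  obtain t where t: "\<And>i. simple_function unit_leb (t i)" "\<And>i. t i \<in> L2_unit"
    "\<And>x. x \<in> {0..1} \<Longrightarrow> (\<lambda>i. t i x) \<longlonglongrightarrow> w x"
    "\<And>i x. x \<in> {0..1} \<Longrightarrow> \<bar>t i x\<bar> \<le> 2 * \<bar>w x\<bar>"
    "(\<lambda>i. L2_unit_norm (t i)) \<longlonglongrightarrow> L2_unit_norm w"
    using L2_unit_simple_approximation[OF w] by blast
  \<comment> \<open>This is the product of \<open>2 * \<bar>u x\<bar> + 2 * \<bar>u y\<bar>\<close>
    and \<open>2 * \<bar>w x\<bar>\<close> expanded, which bounds all approximating integrands at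
    once.\<close>
  let ?B = "\<lambda>p. 4 * \<bar>u (fst p) * w (fst p)\<bar> + 4 * \<bar>u (snd p) * w (fst p)\<bar>"
  have intB: "integrable square_leb ?B"
    using integrable_square_leb_fst_snd(1)[OF L2_unit_mult_integrable[OF u w]]
      integrable_square_leb_L2_mult[OF u w]
    by auto
  have "(\<lambda>i. form (s i) (t i)) \<longlonglongrightarrow> form u w"
  proof (rule integral_dominated_convergence[OF _ _ intB])
    show "(\<lambda>p. g p * ((u (fst p) - u (snd p)) * w (fst p))) \<in> borel_measurable square_leb"
      using integrable_form(2)[OF u w] by auto
    show "(\<lambda>p. g p * ((s i (fst p) - s i (snd p)) * t i (fst p))) \<in> borel_measurable square_leb" for i
      using integrable_form(2)[OF s(2) t(2)] by auto
    show "AE p in square_leb. (\<lambda>i. g p * ((s i (fst p) - s i (snd p)) * t i (fst p)))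
        \<longlonglongrightarrow> g p * ((u (fst p) - u (snd p)) * w (fst p))"
      using s(3) t(3) by (auto intro!: AE_I2 tendsto_intros)
    show "AE p in square_leb. norm (g p * ((s i (fst p) - s i (snd p)) * t i (fst p))) \<le> ?B p" for i
    proof (rule AE_I2)
      fix p assume "p \<in> space square_leb"
      then have p: "fst p \<in> {0..1}" "snd p \<in> {0..1}"
        by auto
      have "norm (g p * ((s i (fst p) - s i (snd p)) * t i (fst p)))
          \<le> \<bar>s i (fst p) - s i (snd p)\<bar> * \<bar>t i (fst p)\<bar>"
        using abs_g_mult_le by (simp flip: abs_mult)
      also have "\<dots> \<le> (2 * \<bar>u (fst p)\<bar> + 2 * \<bar>u (snd p)\<bar>) * (2 * \<bar>w (fst p)\<bar>)"
        using s(4)[OF p(1), of i] s(4)[OF p(2), of i] t(4)[OF p(1), of i] by (intro mult_mono) auto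
      also have "\<dots> = ?B p"
        by (simp add: abs_mult algebra_simps)
      finally show "norm (g p * ((s i (fst p) - s i (snd p)) * t i (fst p))) \<le> ?B p" .
    qed
  qed
  moreover have "form u w = L2_unit_norm w * L2_unit_norm w"
    using form_eq[OF u w] L2_unit_norm_square[of w] by (simp add: w_def power2_eq_square)
  moreover have "(\<lambda>i. c * (L2_unit_norm (s i) * L2_unit_norm (t i))) \<longlonglongrightarrow> c * (L2_unit_norm u * L2_unit_norm w)"
    by (intro tendsto_intros s t)
  ultimately have lim: "(\<lambda>i. form (s i) (t i) - c * (L2_unit_norm (s i) * L2_unit_norm (t i)))
      \<longlonglongrightarrow> L2_unit_norm w * L2_unit_norm w - c * (L2_unit_norm u * L2_unit_norm w)"
    by (auto intro: tendsto_diff)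
  have "c * L2_unit_norm u < L2_unit_norm w"
    using mult_left_mono[OF u1 c(1)] c(2) by (simp add: w_def)
  then have "c * L2_unit_norm u * L2_unit_norm w < L2_unit_norm w * L2_unit_norm w"
    using c by (intro mult_strict_right_mono) (auto simp: w_def)
  then have "0 < L2_unit_norm w * L2_unit_norm w - c * (L2_unit_norm u * L2_unit_norm w)"
    by (simp add: mult.assoc)
  from order_tendstoD(1)[OF lim this]
  obtain i where "0 < form (s i) (t i) - c * (L2_unit_norm (s i) * L2_unit_norm (t i))"
    by (auto simp: eventually_sequentially)
  then show thesis
    using that[OF s(1) t(1) s(2) t(2), of i i] by simp
qed

end

lemma lower_semicontinuous_opnorm_laplacian:
  "lower_semicontinuous_wrt cut_metric graphons (\<lambda>h. opnorm_L2 (laplacian_op h))"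
  unfolding lower_semicontinuous_wrt_def
proof (intro ballI allI impI)
  fix h c assume "h \<in> graphons" and c: "c < opnorm_L2 (laplacian_op h)"
  then obtain g where kg: "kernel_representative g h"
    using graphon_kernel_representative by blast
  then interpret kernel_representative g h .
  show "\<exists>\<epsilon>>0. \<forall>h'\<in>graphons. cut_metric h' h < \<epsilon> \<longrightarrow> c < opnorm_L2 (laplacian_op h')"
  proof (cases "c < 0")
    \<comment> \<open>Operator norms are nonnegative, so every radius works for negative
      \<open>c\<close>.\<close>
    case True
    have "c < opnorm_L2 (laplacian_op h')" if h': "h' \<in> graphons" for h'
    proof -
      obtain g' where "kernel_representative g' h'"
        using graphon_kernel_representative[OF h'] .
      then have "0 \<le> opnorm_L2 (laplacian_op h')"
        by (intro opnorm_L2_properties(2) kernel_representative.bounded_operator_laplacian)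
      with True show ?thesis by simp
    qed
    then show ?thesis
      by (intro exI[of _ 1]) auto
  next
    case False
    have "(\<lambda>_. 0) \<in> {u \<in> L2_unit. L2_unit_norm u \<le> 1}"
      using L2_unit_const[of 0] by (simp add: L2_unit_norm_def)
    with c obtain u where u: "u \<in> L2_unit" "L2_unit_norm u \<le> 1" "c < L2_unit_norm (laplacian_op h u)"
      unfolding opnorm_L2_def
      by (subst (asm) less_cSUP_iff) (use opnorm_L2_properties(1)[OF bounded_operator_laplacian] in auto)
    with False obtain s t where st: "simple_function unit_leb s" "simple_function unit_leb t"
      "s \<in> L2_unit" "t \<in> L2_unit" and less: "c * (L2_unit_norm s * L2_unit_norm t) < form s t"
      using simple_test_functions[OF u(1,2), of c] laplacian_L2(2)[OF u(1)] by auto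
    define A where "A = s ` {0..1} \<union> t ` {0..1}"
    \<comment> \<open>\<open>C\<close> is the Lipschitz constant of the form in the cut distance and
      \<open>d\<close> the slack in \<open>less\<close>. The radius \<open>d / (C + 1)\<close> keeps
      the change below \<open>d\<close>; adding one covers \<open>C = 0\<close>.\<close>
    define C where "C = (\<Sum>(a, b, c)\<in>A \<times> A \<times> A. \<bar>(a - c) * b\<bar>)"
    define d where "d = form s t - c * (L2_unit_norm s * L2_unit_norm t)"
    have "finite A"
      using st(1,2) by (auto simp: A_def simple_function_def)
    have "0 \<le> C"
      unfolding C_def by (intro sum_nonneg) auto
    have "0 < d"
      using less by (simp add: d_def)
    have "c < opnorm_L2 (laplacian_op h')" if h': "h' \<in> graphons" and near: "cut_metric h' h < d / (C + 1)" for h'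
    proof -
      obtain g' where k': "kernel_representative g' h'"
        using graphon_kernel_representative[OF h'] .
      then interpret k': kernel_representative g' h' .
      \<comment> \<open>An infimum below the radius is undercut by some \<open>\<phi>\<close>. The
        identity shows that the set of relabellings is nonempty.\<close>
      obtain \<phi> where \<phi>: "\<phi> \<in> mp_bijections" and cut: "cut_distance h' (relabel h \<phi>) < d / (C + 1)"
        using cInf_lessD[OF _ near[unfolded cut_metric_def]] id_mp_bijections by auto
      define g\<phi> where "g\<phi> = (\<lambda>p. g (\<phi> (fst p), \<phi> (snd p)))"
      have k\<phi>: "kernel_representative g\<phi> (relabel h \<phi>)"
        unfolding g\<phi>_def by (rule relabel_kernel_representative[OF kg \<phi>])
      then interpret k\<phi>: kernel_representative g\<phi> "relabel h \<phi>" .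
      define s' where "s' = (\<lambda>x. s (\<phi> x))"
      define t' where "t' = (\<lambda>x. t (\<phi> x))"
      have st': "s' \<in> L2_unit" "t' \<in> L2_unit"
        and norms: "L2_unit_norm s' = L2_unit_norm s" "L2_unit_norm t' = L2_unit_norm t"
        using mp_bijections_L2[OF st(3) \<phi>] mp_bijections_L2[OF st(4) \<phi>] by (auto simp: s'_def t'_def)
      have "bij_betw \<phi> {0..1} {0..1}"
        using \<phi> by (simp add: mp_bijections_def)
      \<comment> \<open>Since \<open>\<phi>\<close> maps the unit interval to itself, the relabelled
        test functions keep their values in \<open>A\<close>, and \<open>C\<close> serves for every
        \<open>\<phi>\<close>.\<close>
      then have range: "s' ` {0..1} \<subseteq> A" "t' ` {0..1} \<subseteq> A"
        by (auto simp: A_def s'_def t'_def dest: bij_betwE)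
      \<comment> \<open>Relabelling the kernel and both test functions together is a measure
        preserving change of variables.\<close>
      have "form s t = k\<phi>.form s' t'"
        using relabel_kernel_representative(2)[OF kg \<phi>, of "\<lambda>p. g p * ((s (fst p) - s (snd p)) * t (fst p))"]
          integrable_form(2)[OF st(3,4)]
        by (simp add: g\<phi>_def s'_def t'_def)
      moreover have "k'.form s' t' - k\<phi>.form s' t'
          = (LINT p|square_leb. (g' p - g\<phi> p) * ((s' (fst p) - s' (snd p)) * t' (fst p)))"
        using k'.integrable_form(2)[OF st'] k\<phi>.integrable_form(2)[OF st']
        by (simp add: left_diff_distrib)
      moreover have "\<bar>\<dots>\<bar> \<le> C * cut_distance h' (relabel h \<phi>)"
        unfolding C_def using st' range \<open>finite A\<close>
        by (intro simple_form_cut_distance_le[OF k' k\<phi>] L2_unit_measurable)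
      moreover have "C * cut_distance h' (relabel h \<phi>) \<le> C * (d / (C + 1))"
        using cut \<open>0 \<le> C\<close> by (intro mult_left_mono) auto
      moreover have "C * (d / (C + 1)) < d"
        using \<open>0 \<le> C\<close> \<open>0 < d\<close> by (simp add: field_simps)
      ultimately have "c * (L2_unit_norm s' * L2_unit_norm t') < k'.form s' t'"
        unfolding norms d_def by linarith
      also have "\<dots> \<le> L2_unit_norm (k'.rep_op s') * L2_unit_norm t'"
        unfolding k'.form_eq[OF st'] by (intro L2_unit_Cauchy_Schwarz k'.rep_op_L2 st')
      also have "\<dots> \<le> opnorm_L2 (laplacian_op h') * L2_unit_norm s' * L2_unit_norm t'"
        using opnorm_L2_properties(3)[OF k'.bounded_operator_laplacian st'(1)] k'.laplacian_L2(2)[OF st'(1)]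
        by (intro mult_right_mono L2_unit_norm_nonneg) auto
      finally have "c * (L2_unit_norm s' * L2_unit_norm t')
          < opnorm_L2 (laplacian_op h') * (L2_unit_norm s' * L2_unit_norm t')"
        by (simp add: mult.assoc)
      \<comment> \<open>The common factor is nonnegative; were it zero, the strict inequality would
        fail, so it can be cancelled.\<close>
      then show ?thesis
        by (rule mult_right_less_imp_less) (simp add: L2_unit_norm_nonneg)
    qed
    then show ?thesis
      using \<open>0 < d\<close> \<open>0 \<le> C\<close> by (intro exI[of _ "d / (C + 1)"]) auto
  qed
qed

subsection \<open>Empirical graphons\<close>

text \<open>Edges through a vertex correspond to its neighbours, because every edge has exactly two
  ends. This turns the diagonal entry into a row sum of the adjacency matrix.\<close>

lemma simple_graph_degree:
  assumes "simple_graph N E"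
  shows "real (card {e \<in> E. Suc i \<in> e}) = (\<Sum>j<N. if {Suc i, Suc j} \<in> E then 1 else 0)"
proof -
  let ?J = "{j \<in> {..<N}. {Suc i, Suc j} \<in> E}"
  have "(\<lambda>j. {Suc i, Suc j}) ` ?J = {e \<in> E. Suc i \<in> e}"
  proof (intro equalityI subsetI)
    fix e assume "e \<in> {e \<in> E. Suc i \<in> e}"
    then have e: "e \<in> E" "Suc i \<in> e" "e \<subseteq> {1..N}" "card e = 2"
      using assms by (auto simp: simple_graph_def)
    then obtain k where k: "e = {Suc i, k}"
      by (auto simp: card_2_iff)
    with e obtain j where "k = Suc j" "j < N"
      by (cases k) auto
    with e k show "e \<in> (\<lambda>j. {Suc i, Suc j}) ` ?J"
      by (intro image_eqI[of _ _ j]) auto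
  qed auto
  moreover have "card ((\<lambda>j. {Suc i, Suc j}) ` ?J) = card ?J"
    by (rule card_image) (auto simp: inj_on_def doubleton_eq_iff)
  ultimately have "card {e \<in> E. Suc i \<in> e} = card ?J"
    by simp
  also have "real (card ?J) = (\<Sum>j<N. if {Suc i, Suc j} \<in> E then 1 else 0)"
    by (simp add: sum.If_cases Int_def)
  finally show ?thesis .
qed

lemma empirical_graphon_graphons: "empirical_graphon N E \<in> graphons"
proof -
  have "(\<lambda>p::real \<times> real. nat \<lceil>real N * fst p\<rceil>) \<in> measurable (borel \<Otimes>\<^sub>M borel) (count_space UNIV)"
    "(\<lambda>p::real \<times> real. nat \<lceil>real N * snd p\<rceil>) \<in> measurable (borel \<Otimes>\<^sub>M borel) (count_space UNIV)"
    by measurable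
  then have m: "(\<lambda>p::real \<times> real. nat \<lceil>real N * fst p\<rceil>) \<in> measurable borel (count_space UNIV)"
    "(\<lambda>p::real \<times> real. nat \<lceil>real N * snd p\<rceil>) \<in> measurable borel (count_space UNIV)"
    unfolding borel_prod .
  \<comment> \<open>The two vertex indices are measurable with countably many values. Composition
    with a countable-valued map is used once per coordinate, here with the first index
    frozen.\<close>
  have "(\<lambda>p::real \<times> real. if {i, nat \<lceil>real N * snd p\<rceil>} \<in> E then 1 else 0 :: real) \<in> borel_measurable borel" for i
    by (rule measurable_compose_countable[OF _ m(2), where f = "\<lambda>j p. if {i, j} \<in> E then 1 else 0"]) simp
  from measurable_compose_countable[OF this m(1)]
  have "(\<lambda>(x, y). empirical_graphon N E x y) \<in> borel_measurable borel"
    by (simp add: empirical_graphon_def case_prod_beta')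
  then have "(\<lambda>(x, y). empirical_graphon N E x y) \<in> borel_measurable (lebesgue_on unit_square)"
    by (intro measurable_restrict_space1 measurable_completion) simp
  moreover have "empirical_graphon N E x y \<in> {0..1} \<and> empirical_graphon N E x y = empirical_graphon N E y x" for x y
    by (simp add: empirical_graphon_def insert_commute)
  ultimately show ?thesis
    by (simp add: graphons_def)
qed

section \<open>The Laplacian matrix acting on vectors\<close>

context
  fixes N :: nat and E :: "nat set set"
  assumes N: "1 \<le> N" and graph: "simple_graph N E"
begin

abbreviation adj :: "nat \<Rightarrow> nat \<Rightarrow> real" where
  "adj i j \<equiv> if {Suc i, Suc j} \<in> E then 1 else 0"

definition deg :: "nat \<Rightarrow> real" where
  "deg i = (\<Sum>j<N. adj i j)"

definition lap :: "(nat \<Rightarrow> real) \<Rightarrow> nat \<Rightarrow> real" where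
  "lap v i = deg i * v i - (\<Sum>j<N. adj i j * v j)"

text \<open>Vectors are represented by functions on all naturals, of which only the values below
  \<open>N\<close> count; this avoids carrier conditions.\<close>

definition norm2 :: "(nat \<Rightarrow> real) \<Rightarrow> real" where
  "norm2 v = sqrt (\<Sum>i<N. (v i)\<^sup>2)"

lemma norm2_nonneg: "0 \<le> norm2 v"
  by (simp add: norm2_def sum_nonneg)

lemma norm2_square: "(norm2 v)\<^sup>2 = (\<Sum>i<N. (v i)\<^sup>2)"
  by (simp add: norm2_def sum_nonneg)

lemma norm2_cmult: "norm2 (\<lambda>i. c * v i) = \<bar>c\<bar> * norm2 v"
  by (simp add: norm2_def power_mult_distrib real_sqrt_mult flip: sum_distrib_left)

lemma lap_cmult: "lap (\<lambda>i. c * v i) = (\<lambda>i. c * lap v i)"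
  by (simp add: lap_def fun_eq_iff algebra_simps sum_distrib_left)

lemma euclidean_norm_eq: "v \<in> carrier_vec N \<Longrightarrow> euclidean_norm v = norm2 (vec_index v)"
  by (auto simp: euclidean_norm_def norm2_def scalar_prod_def power2_eq_square lessThan_atLeast0)

lemma euclidean_norm_laplacian_matrix:
  assumes v: "v \<in> carrier_vec N"
  shows "euclidean_norm (laplacian_matrix N E *\<^sub>v v) = norm2 (lap (vec_index v))"
proof -
  have carrier: "laplacian_matrix N E \<in> carrier_mat N N"
    by (auto simp: laplacian_matrix_def degree_matrix_def adjacency_matrix_def)
  have entry: "laplacian_matrix N E $$ (i, j) = (if i = j then deg i else 0) - adj i j" if "i < N" "j < N" for i j
    using that
    by (simp add: simple_graph_degree[OF graph] laplacian_matrix_def degree_matrix_def adjacency_matrix_def mat_diag_def deg_def)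
  have "vec_index (laplacian_matrix N E *\<^sub>v v) i = lap (vec_index v) i" if i: "i < N" for i
  proof -
    have "vec_index (laplacian_matrix N E *\<^sub>v v) i
        = (\<Sum>j<N. ((if i = j then deg i else 0) - adj i j) * vec_index v j)"
      using i v carrier by (auto simp: scalar_prod_def entry lessThan_atLeast0 intro!: sum.cong)
    also have "\<dots> = (\<Sum>j<N. (if i = j then deg i * vec_index v j else 0) - adj i j * vec_index v j)"
      by (intro sum.cong) (auto simp: algebra_simps)
    also have "\<dots> = lap (vec_index v) i"
      using i by (simp add: sum_subtractf lap_def)
    finally show ?thesis .
  qed
  moreover have "laplacian_matrix N E *\<^sub>v v \<in> carrier_vec N"
    using carrier v by (rule mult_mat_vec_carrier)
  ultimately show ?thesis
    by (simp add: euclidean_norm_eq norm2_def)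
qed

text \<open>Cutting a function off at \<open>N\<close> gives a vector and changes neither norm, so
  both suprema range over the same set of values.\<close>

lemma spectral_norm_eq: "spectral_norm (laplacian_matrix N E) = (SUP v\<in>{v. norm2 v \<le> 1}. norm2 (lap v))"
proof -
  have dim: "dim_col (laplacian_matrix N E) = N"
    by (simp add: laplacian_matrix_def degree_matrix_def adjacency_matrix_def)
  have "(\<lambda>v. euclidean_norm (laplacian_matrix N E *\<^sub>v v)) ` {v \<in> carrier_vec N. euclidean_norm v \<le> 1}
      = (\<lambda>v. norm2 (lap v)) ` {v. norm2 v \<le> 1}" (is "?l = ?r")
  proof (intro equalityI image_subsetI)
    fix v assume "v \<in> {v \<in> carrier_vec N. euclidean_norm v \<le> 1}"
    then show "euclidean_norm (laplacian_matrix N E *\<^sub>v v) \<in> ?r"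
      by (auto simp: euclidean_norm_laplacian_matrix euclidean_norm_eq)
  next
    fix f assume f: "f \<in> {v. norm2 v \<le> 1}"
    have v: "Matrix.vec N f \<in> carrier_vec N"
      by simp
    have "norm2 (vec_index (Matrix.vec N f)) = norm2 f"
      "norm2 (lap (vec_index (Matrix.vec N f))) = norm2 (lap f)"
      by (auto simp: norm2_def lap_def intro!: sum.cong)
    with f v show "norm2 (lap f) \<in> ?l"
      by (intro image_eqI[of _ _ "Matrix.vec N f"]) (auto simp: euclidean_norm_laplacian_matrix euclidean_norm_eq)
  qed
  then show ?thesis
    by (simp add: spectral_norm_def dim)
qed

text \<open>Some bound \<open>C\<close> is needed for the supremum to be meaningful. It will be
  \<open>N\<close> times the operator norm of the graphon Laplacian, so the first claim is then one
  half of the desired equality.\<close>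

lemma spectral_norm_properties:
  assumes C: "\<And>v. norm2 (lap v) \<le> C * norm2 v" and "0 \<le> C"
  shows "spectral_norm (laplacian_matrix N E) \<le> C"
    and "norm2 (lap v) \<le> spectral_norm (laplacian_matrix N E) * norm2 v"
proof -
  have le: "norm2 (lap v) \<le> C" if "norm2 v \<le> 1" for v
    using C[of v] mult_left_mono[OF that \<open>0 \<le> C\<close>] by simp
  have bdd: "bdd_above ((\<lambda>v. norm2 (lap v)) ` {v. norm2 v \<le> 1})"
    by (rule bdd_aboveI2) (use le in auto)
  have ne: "(\<lambda>_. 0) \<in> {v. norm2 v \<le> 1}"
    by (simp add: norm2_def)
  show "spectral_norm (laplacian_matrix N E) \<le> C"
    unfolding spectral_norm_eq by (rule cSUP_least) (use ne le in auto)
  have upper: "norm2 (lap v) \<le> spectral_norm (laplacian_matrix N E)" if "norm2 v \<le> 1" for v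
    unfolding spectral_norm_eq using that by (intro cSUP_upper bdd) auto
  show "norm2 (lap v) \<le> spectral_norm (laplacian_matrix N E) * norm2 v"
  proof (cases "norm2 v = 0")
    case True
    with C[of v] show ?thesis by simp
  next
    case False
    then have pos: "0 < norm2 v"
      using norm2_nonneg[of v] by simp
    have "norm2 (lap (\<lambda>i. inverse (norm2 v) * v i)) \<le> spectral_norm (laplacian_matrix N E)"
      using pos by (intro upper) (simp add: norm2_cmult)
    then have "\<bar>inverse (norm2 v)\<bar> * norm2 (lap v) \<le> spectral_norm (laplacian_matrix N E)"
      unfolding lap_cmult norm2_cmult .
    with pos show ?thesis
      by (simp add: field_simps)
  qed
qed

section \<open>Partition of the unit interval into cells\<close>

text \<open>Open on the left to match the ceiling in \<open>empirical_graphon\<close>. Cell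
  \<open>i\<close> belongs to vertex \<open>Suc i\<close>, and the point \<open>0\<close> lies in no
  cell.\<close>

definition cell :: "nat \<Rightarrow> real set" where
  "cell i = {real i / real N <.. real (Suc i) / real N}"

lemma cell_index: "x \<in> cell i \<longleftrightarrow> nat \<lceil>real N * x\<rceil> = Suc i"
proof -
  have "x \<in> cell i \<longleftrightarrow> real i < real N * x \<and> real N * x \<le> real (Suc i)"
    using N by (simp add: cell_def field_simps)
  also have "\<dots> \<longleftrightarrow> \<lceil>real N * x\<rceil> = int (Suc i)"
    by (simp add: ceiling_eq_iff)
  also have "\<dots> \<longleftrightarrow> nat \<lceil>real N * x\<rceil> = Suc i"
    by linarith
  finally show ?thesis .
qed

lemma cell_subset:
  assumes "i < N"
  shows "cell i \<subseteq> {0..1}"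
proof
  fix x assume "x \<in> cell i"
  then have "real i / real N < x" "x \<le> real (Suc i) / real N"
    by (simp_all only: cell_def greaterThanAtMost_iff)
  moreover have "0 \<le> real i / real N" "real (Suc i) / real N \<le> 1"
    using assms by auto
  ultimately show "x \<in> {0..1}"
    unfolding atLeastAtMost_iff by linarith
qed

lemma cell_sets: "i < N \<Longrightarrow> cell i \<in> sets unit_leb"
  using cell_subset[of i] by (simp add: sets_restrict_space_iff) (simp add: cell_def)

text \<open>The intersection with \<open>{0..1}\<close> is the form in which \<open>simp\<close>
  leaves the integral of an indicator.\<close>

lemma measure_cell:
  assumes "i < N"
  shows "measure unit_leb (cell i \<inter> {0..1}) = 1 / real N"
proof -
  have "measure unit_leb (cell i \<inter> {0..1}) = measure lebesgue (cell i)"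
    using cell_subset[OF assms] by (simp add: Int_absorb2 measure_restrict_space)
  also have "\<dots> = 1 / real N"
    using N by (simp add: cell_def field_simps)
  finally show ?thesis .
qed

lemma integral_cell: "i < N \<Longrightarrow> (LINT x|unit_leb. indicator (cell i) x) = 1 / real N"
  by (simp add: measure_cell)

lemma sum_cell:
  fixes f :: "nat \<Rightarrow> real"
  assumes "i < N" "x \<in> cell i"
  shows "(\<Sum>j<N. indicator (cell j) x * f j) = f i"
proof -
  have "(\<Sum>j<N. indicator (cell j) x * f j) = (\<Sum>j<N. if j = i then f j else 0)"
    using assms by (intro sum.cong) (auto simp: indicator_def cell_index)
  also have "\<dots> = f i"
    using assms by (subst sum.delta) auto
  finally show ?thesis .
qed

text \<open>The cells miss only the point \<open>0\<close> of the unit interval, which is a null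
  set.\<close>

lemma AE_cell: "AE x in unit_leb. \<exists>i<N. x \<in> cell i"
proof -
  have "AE x in lborel. x \<noteq> (0 :: real)"
    by (rule AE_lborel_singleton)
  then have "AE x in lebesgue. x \<noteq> (0 :: real)"
    by (rule AE_completion)
  then have "AE x in lebesgue. x \<in> {0..1} \<longrightarrow> (\<exists>i<N. x \<in> cell i)"
  proof eventually_elim
    case (elim x)
    show ?case
    proof
      assume x: "x \<in> {0..1}"
      with elim N have pos: "0 < real N * x" "real N * x \<le> real N"
        by (auto intro: mult_left_le)
      then have "0 < \<lceil>real N * x\<rceil>" "\<lceil>real N * x\<rceil> \<le> int N"
        by (auto simp: ceiling_le_iff)
      then have "nat \<lceil>real N * x\<rceil> - 1 < N" "nat \<lceil>real N * x\<rceil> = Suc (nat \<lceil>real N * x\<rceil> - 1)"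
        by linarith+
      then show "\<exists>i<N. x \<in> cell i"
        unfolding cell_index by blast
    qed
  qed
  then show ?thesis
    by (subst AE_restrict_space_iff) auto
qed

lemma integrable_cell:
  fixes f :: "real \<Rightarrow> real"
  assumes "integrable unit_leb f" "i < N"
  shows "integrable unit_leb (\<lambda>x. indicator (cell i) x * f x)"
  using integrable_mult_indicator[OF cell_sets assms(1)] assms(2) by simp

lemma integral_eq_sum_cells:
  fixes f :: "real \<Rightarrow> real"
  assumes f: "integrable unit_leb f"
  shows "(LINT x|unit_leb. f x) = (\<Sum>i<N. LINT x|unit_leb. indicator (cell i) x * f x)"
proof -
  have "AE x in unit_leb. f x = (\<Sum>i<N. indicator (cell i) x * f x)"
    using AE_cell
  proof eventually_elim
    case (elim x)
    then obtain i where i: "i < N" "x \<in> cell i" by blast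
    show ?case
      using sum_cell[OF i, of "\<lambda>_. f x"] by (rule sym)
  qed
  then have "(LINT x|unit_leb. f x) = (LINT x|unit_leb. (\<Sum>i<N. indicator (cell i) x * f x))"
    using integrable_cell[OF f]
    by (intro integral_cong_AE borel_measurable_integrable Bochner_Integration.integrable_sum f) simp_all
  also have "\<dots> = (\<Sum>i<N. LINT x|unit_leb. indicator (cell i) x * f x)"
    using integrable_cell[OF f] by (subst Bochner_Integration.integral_sum) auto
  finally show ?thesis .
qed

text \<open>A cell has measure \<open>1 / real N\<close>, so the factor turns the integral into an
  average.\<close>

definition mean :: "(real \<Rightarrow> real) \<Rightarrow> nat \<Rightarrow> real" where
  "mean u i = real N * (LINT x|unit_leb. indicator (cell i) x * u x)"

definition energy :: "(real \<Rightarrow> real) \<Rightarrow> nat \<Rightarrow> real" where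
  "energy u i = (LINT x|unit_leb. indicator (cell i) x * (u x)\<^sup>2)"

text \<open>For \<open>x\<close> in cell \<open>i\<close> the kernel equals \<open>adj i j\<close>
  for every \<open>y\<close> in cell \<open>j\<close>, so the integral over \<open>y\<close> splits
  into finitely many cell integrals.\<close>

lemma laplacian_empirical_cell:
  assumes u: "u \<in> L2_unit" and x: "x \<in> cell i" and i: "i < N"
  shows "laplacian_op (empirical_graphon N E) u x = (deg i * u x - (\<Sum>j<N. adj i j * mean u j)) / real N"
proof -
  let ?h = "empirical_graphon N E"
  have u': "integrable unit_leb u"
    using u by (rule L2_unit_integrable)
  have ind: "integrable unit_leb (\<lambda>y. indicator (cell j) y :: real)" if "j < N" for j
    using integrable_cell[of "\<lambda>_. 1" j] that by simp
  let ?F = "\<lambda>y. \<Sum>j<N. adj i j * (indicator (cell j) y * u x - indicator (cell j) y * u y)"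
  have int: "integrable unit_leb ?F"
    using ind integrable_cell[OF u'] by (intro Bochner_Integration.integrable_sum) auto
  have eq: "AE y in unit_leb. ?F y = ?h x y * (u x - u y)"
    using AE_cell
  proof eventually_elim
    case (elim y)
    then obtain k where k: "k < N" "y \<in> cell k" by blast
    have "?F y = (\<Sum>j<N. indicator (cell j) y * (adj i j * (u x - u y)))"
      by (intro sum.cong) (auto simp: algebra_simps)
    also have "\<dots> = adj i k * (u x - u y)"
      using k by (rule sum_cell)
    also have "adj i k = ?h x y"
      using x k by (simp add: empirical_graphon_def cell_index)
    finally show ?case .
  qed
  have "laplacian_op ?h u x = (LINT y|unit_leb. ?F y)"
    unfolding laplacian_op_def
  proof (rule integral_cong_AE)
    show F: "?F \<in> borel_measurable unit_leb"
      using int by (rule borel_measurable_integrable)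
    show "(\<lambda>y. ?h x y * (u x - u y)) \<in> borel_measurable unit_leb"
      by (rule measurable_AE_eq[OF F _ eq]) auto
    show "AE y in unit_leb. ?h x y * (u x - u y) = ?F y"
      using eq by eventually_elim simp
  qed
  also have "\<dots> = (\<Sum>j<N. adj i j * (u x / real N - mean u j / real N))"
    using ind integrable_cell[OF u'] N
    by (subst Bochner_Integration.integral_sum) (auto simp: measure_cell mean_def intro!: sum.cong)
  also have "\<dots> = (deg i * u x - (\<Sum>j<N. adj i j * mean u j)) / real N"
    by (simp add: deg_def right_diff_distrib sum_subtractf sum_distrib_right sum_divide_distrib diff_divide_distrib)
  finally show ?thesis .
qed

text \<open>Variance decomposition on one cell: the bracket is the integral of the squared deviation
  of \<open>u\<close> from its cell average. The map \<open>s * u x - t\<close> scales it by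
  \<open>s\<^sup>2\<close> and sends the average to \<open>s * mean u i - t\<close>.\<close>

lemma integral_cell_affine_square:
  assumes u: "u \<in> L2_unit" and i: "i < N"
  shows "(LINT x|unit_leb. indicator (cell i) x * (s * u x - t)\<^sup>2)
    = s\<^sup>2 * (energy u i - (mean u i)\<^sup>2 / real N) + (s * mean u i - t)\<^sup>2 / real N"
proof -
  have ind: "integrable unit_leb (\<lambda>y. indicator (cell i) y :: real)"
    using integrable_cell[of "\<lambda>_. 1" i] i by simp
  have "(LINT x|unit_leb. indicator (cell i) x * (s * u x - t)\<^sup>2)
    = (LINT x|unit_leb. s\<^sup>2 * (indicator (cell i) x * (u x)\<^sup>2) - 2 * s * t * (indicator (cell i) x * u x)
        + t\<^sup>2 * indicator (cell i) x)"
    by (intro Bochner_Integration.integral_cong) (auto simp: power2_eq_square algebra_simps)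
  also have "\<dots> = s\<^sup>2 * energy u i - 2 * s * t * (mean u i / real N) + t\<^sup>2 * (1 / real N)"
    using N ind integrable_cell[OF L2_unit_integrable[OF u] i] integrable_cell[OF L2_unit_square_integrable[OF u] i]
      integral_cell[OF i]
    by (simp add: energy_def mean_def)
  also have "\<dots> = s\<^sup>2 * (energy u i - (mean u i)\<^sup>2 / real N) + (s * mean u i - t)\<^sup>2 / real N"
    using N by (simp add: field_simps power2_eq_square)
  finally show ?thesis .
qed

lemma mean_square_le_energy:
  assumes u: "u \<in> L2_unit" and i: "i < N"
  shows "(mean u i)\<^sup>2 / real N \<le> energy u i"
proof -
  \<comment> \<open>With \<open>s = 1\<close> and \<open>t = mean u i\<close> only the variance
    remains; the factor \<open>1\<close> is written out to match the decomposition.\<close>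
  have "0 \<le> (LINT x|unit_leb. indicator (cell i) x * (1 * u x - mean u i)\<^sup>2)"
    by (rule Bochner_Integration.integral_nonneg) simp
  then show ?thesis
    unfolding integral_cell_affine_square[OF u i] by simp
qed

lemma L2_unit_norm_eq_sum_energy: "u \<in> L2_unit \<Longrightarrow> (L2_unit_norm u)\<^sup>2 = (\<Sum>i<N. energy u i)"
  by (simp add: L2_unit_norm_square energy_def integral_eq_sum_cells L2_unit_square_integrable)

text \<open>On each cell the deviation from the average is multiplied by
  \<open>deg i / real N\<close>, while the averages undergo \<open>lap\<close> divided by
  \<open>N\<close>. The cube combines the square of that factor with the measure of a cell.\<close>

lemma laplacian_empirical_norm:
  assumes u: "u \<in> L2_unit"
  shows "(L2_unit_norm (laplacian_op (empirical_graphon N E) u))\<^sup>2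
    = (\<Sum>i<N. (deg i / real N)\<^sup>2 * (energy u i - (mean u i)\<^sup>2 / real N)) + (norm2 (lap (mean u)))\<^sup>2 / real N ^ 3"
proof -
  let ?L = "laplacian_op (empirical_graphon N E)"
  obtain g where "kernel_representative g (empirical_graphon N E)"
    using graphon_kernel_representative[OF empirical_graphon_graphons] .
  then have L: "?L u \<in> L2_unit"
    using u by (rule kernel_representative.laplacian_L2)
  define b where "b i = (\<Sum>j<N. adj i j * mean u j)" for i
  have "energy (?L u) i = (deg i / real N)\<^sup>2 * (energy u i - (mean u i)\<^sup>2 / real N) + (lap (mean u) i)\<^sup>2 / real N ^ 3"
    if i: "i < N" for i
  proof -
    have "energy (?L u) i = (LINT x|unit_leb. indicator (cell i) x * (deg i / real N * u x - b i / real N)\<^sup>2)"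
      unfolding energy_def using laplacian_empirical_cell[OF u _ i]
      by (intro Bochner_Integration.integral_cong) (auto simp: indicator_def b_def diff_divide_distrib)
    also have "\<dots> = (deg i / real N)\<^sup>2 * (energy u i - (mean u i)\<^sup>2 / real N)
        + (deg i / real N * mean u i - b i / real N)\<^sup>2 / real N"
      by (rule integral_cell_affine_square[OF u i])
    also have "deg i / real N * mean u i - b i / real N = lap (mean u) i / real N"
      by (simp add: lap_def b_def diff_divide_distrib)
    finally show ?thesis
      by (simp add: power_divide power3_eq_cube power2_eq_square)
  qed
  then show ?thesis
    by (simp add: L2_unit_norm_eq_sum_energy[OF L] norm2_square sum.distrib sum_divide_distrib)
qed

text \<open>Embeds vectors as functions without variance on any cell: energy and squared mean cancel
  in \<open>laplacian_empirical_norm\<close>.\<close>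

lemma step_function:
  fixes v :: "nat \<Rightarrow> real"
  defines "u \<equiv> \<lambda>x. \<Sum>j<N. indicator (cell j) x * v j"
  shows "u \<in> L2_unit" and "i < N \<Longrightarrow> mean u i = v i" and "i < N \<Longrightarrow> energy u i = (v i)\<^sup>2 / real N"
proof -
  have "u \<in> borel_measurable unit_leb"
    unfolding u_def using cell_sets by (intro borel_measurable_sum borel_measurable_times borel_measurable_indicator) auto
  moreover have "integrable unit_leb (\<lambda>x. (u x)\<^sup>2)"
  proof (rule Bochner_Integration.integrable_bound)
    show "integrable unit_leb (\<lambda>_. (\<Sum>j<N. \<bar>v j\<bar>)\<^sup>2)"
      by simp
    show "(\<lambda>x. (u x)\<^sup>2) \<in> borel_measurable unit_leb"
      using calculation by measurable
    have "\<bar>u x\<bar> \<le> (\<Sum>j<N. \<bar>v j\<bar>)" for x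
      unfolding u_def by (rule order_trans[OF sum_abs]) (auto simp: indicator_def intro!: sum_mono)
    then show "AE x in unit_leb. norm ((u x)\<^sup>2) \<le> norm ((\<Sum>j<N. \<bar>v j\<bar>)\<^sup>2)"
      by (auto simp flip: abs_le_square_iff intro: order_trans[OF _ abs_ge_self])
  qed
  ultimately show "u \<in> L2_unit"
    by (simp add: L2_unit_def)
  assume i: "i < N"
  have u: "u x = v i" if "x \<in> cell i" for x
    unfolding u_def by (rule sum_cell[OF i that])
  have "mean u i = real N * (LINT x|unit_leb. indicator (cell i) x * v i)"
    unfolding mean_def using u
    by (intro arg_cong[where f = "\<lambda>z. real N * z"] Bochner_Integration.integral_cong) (auto simp: indicator_def)
  also have "\<dots> = v i"
    using N integral_cell[OF i] by simp
  finally show "mean u i = v i" .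
  have "energy u i = (LINT x|unit_leb. indicator (cell i) x * (v i)\<^sup>2)"
    unfolding energy_def using u by (intro Bochner_Integration.integral_cong) (auto simp: indicator_def)
  also have "\<dots> = (v i)\<^sup>2 / real N"
    using integral_cell[OF i] by simp
  finally show "energy u i = (v i)\<^sup>2 / real N" .
qed

lemma spectral_norm_laplacian_matrix:
  "spectral_norm (laplacian_matrix N E) / real N = opnorm_L2 (laplacian_op (empirical_graphon N E))"
proof -
  let ?L = "laplacian_op (empirical_graphon N E)"
  let ?op = "opnorm_L2 ?L"
  define \<sigma> where "\<sigma> = spectral_norm (laplacian_matrix N E)"
  obtain g where "kernel_representative g (empirical_graphon N E)"
    using graphon_kernel_representative[OF empirical_graphon_graphons] .
  then have bounded: "bounded_operator_L2 ?L"
    by (rule kernel_representative.bounded_operator_laplacian)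
  have op: "0 \<le> real N * ?op"
    using opnorm_L2_properties(2)[OF bounded] by simp
  have le: "norm2 (lap v) \<le> real N * ?op * norm2 v" for v
  proof (rule power2_le_imp_le)
    \<comment> \<open>For this step function the degree terms of
      \<open>laplacian_empirical_norm\<close> vanish, leaving the matrix term alone.\<close>
    define u where "u = (\<lambda>x. \<Sum>j<N. indicator (cell j) x * v j)"
    note u = step_function[where v = v, folded u_def]
    have "norm2 (lap (mean u)) = norm2 (lap v)"
      using u(2) by (simp add: norm2_def lap_def)
    then have "(norm2 (lap v))\<^sup>2 / real N ^ 3 = (L2_unit_norm (?L u))\<^sup>2"
      using u(2,3) by (simp add: laplacian_empirical_norm[OF u(1)])
    also have "\<dots> \<le> (?op * L2_unit_norm u)\<^sup>2"
      by (intro power_mono opnorm_L2_properties(3)[OF bounded] u L2_unit_norm_nonneg)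
    also have "\<dots> = ?op\<^sup>2 * ((norm2 v)\<^sup>2 / real N)"
      using u(3) by (simp add: power_mult_distrib L2_unit_norm_eq_sum_energy[OF u(1)] norm2_square sum_divide_distrib)
    finally have "(norm2 (lap v))\<^sup>2 / real N ^ 3 * real N ^ 3 \<le> ?op\<^sup>2 * ((norm2 v)\<^sup>2 / real N) * real N ^ 3"
      by (rule mult_right_mono) simp
    then show "(norm2 (lap v))\<^sup>2 \<le> (real N * ?op * norm2 v)\<^sup>2"
      using N by (simp add: power3_eq_cube power2_eq_square mult_ac)
    show "0 \<le> real N * ?op * norm2 v"
      using op norm2_nonneg by (rule mult_nonneg_nonneg)
  qed
  note \<sigma> = spectral_norm_properties[OF le op, folded \<sigma>_def]
  have deg_le: "(deg i / real N)\<^sup>2 \<le> (\<sigma> / real N)\<^sup>2" if i: "i < N" for i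
  proof -
    \<comment> \<open>The unit vector at \<open>i\<close>: its image has \<open>deg i\<close> as
      entry \<open>i\<close>, so the degree is bounded by \<sigma>.\<close>
    define v where "v j = (if j = i then 1 else 0 :: real)" for j
    \<comment> \<open>This set is \<open>{Suc i, Suc i}\<close>: there is no loop, and the diagonal
      adjacency entry is zero.\<close>
    have "{Suc i} \<notin> E"
      using graph by (auto simp: simple_graph_def)
    then have "lap v i = deg i"
      using i by (simp add: lap_def v_def if_distrib[of "\<lambda>t. _ * t"] cong: if_cong)
    moreover have "norm2 v = 1"
      using i by (simp add: norm2_def v_def if_distrib[of "\<lambda>t. t\<^sup>2"] cong: if_cong)
    moreover have "(lap v i)\<^sup>2 \<le> (norm2 (lap v))\<^sup>2"
      unfolding norm2_square using i by (intro member_le_sum) auto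
    moreover have "(norm2 (lap v))\<^sup>2 \<le> (\<sigma> * norm2 v)\<^sup>2"
      by (intro power_mono \<sigma> norm2_nonneg)
    ultimately show ?thesis
      by (simp add: power_divide divide_right_mono)
  qed
  have "0 \<le> \<sigma>"
  proof -
    \<comment> \<open>Any vector of positive norm shows that \<sigma> is nonnegative; the constant
      vector one is such a vector.\<close>
    have "norm2 (\<lambda>_. 1) = sqrt (real N)"
      by (simp add: norm2_def)
    then have "0 \<le> \<sigma> * sqrt (real N)"
      using \<sigma>(2)[of "\<lambda>_. 1"] norm2_nonneg[of "lap (\<lambda>_. 1)"] by simp
    with N show ?thesis
      by (simp add: zero_le_mult_iff)
  qed
  have "?op \<le> \<sigma> / real N"
    unfolding opnorm_L2_def
  proof (rule cSUP_least)
    have "(\<lambda>_. 0) \<in> {u \<in> L2_unit. L2_unit_norm u \<le> 1}"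
      using L2_unit_const[of 0] by (simp add: L2_unit_norm_def)
    then show "{u \<in> L2_unit. L2_unit_norm u \<le> 1} \<noteq> {}"
      by blast
  next
    fix u assume "u \<in> {u \<in> L2_unit. L2_unit_norm u \<le> 1}"
    then have u: "u \<in> L2_unit" and u1: "L2_unit_norm u \<le> 1"
      by auto
    \<comment> \<open>The variances are nonnegative by \<open>mean_square_le_energy\<close>, so
      degrees may be replaced by \<sigma> in front of them; the matrix term is bounded by \<sigma>
      directly.\<close>
    have "(L2_unit_norm (?L u))\<^sup>2
        \<le> (\<Sum>i<N. (\<sigma> / real N)\<^sup>2 * (energy u i - (mean u i)\<^sup>2 / real N)) + (\<sigma> * norm2 (mean u))\<^sup>2 / real N ^ 3"
      unfolding laplacian_empirical_norm[OF u]
      using mean_square_le_energy[OF u]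
      by (intro add_mono sum_mono mult_right_mono deg_le divide_right_mono power_mono[OF \<sigma>(2)] norm2_nonneg) auto
    also have "(\<sigma> * norm2 (mean u))\<^sup>2 / real N ^ 3 = \<sigma>\<^sup>2 * (\<Sum>i<N. (mean u i)\<^sup>2) / real N ^ 3"
      by (simp only: power_mult_distrib norm2_square)
    also have "\<dots> = (\<sigma> / real N)\<^sup>2 * (\<Sum>i<N. (mean u i)\<^sup>2 / real N)"
      by (simp add: power_divide power3_eq_cube power2_eq_square[of "real N"] flip: sum_divide_distrib)
    \<comment> \<open>Both parts now carry the same factor, and the squared means subtracted in the
      variances are added back by the second sum.\<close>
    also have "(\<Sum>i<N. (\<sigma> / real N)\<^sup>2 * (energy u i - (mean u i)\<^sup>2 / real N))
        + (\<sigma> / real N)\<^sup>2 * (\<Sum>i<N. (mean u i)\<^sup>2 / real N) = (\<sigma> / real N)\<^sup>2 * (L2_unit_norm u)\<^sup>2"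
      unfolding L2_unit_norm_eq_sum_energy[OF u] sum_distrib_left[symmetric] sum_subtractf
      by (simp add: right_diff_distrib)
    also have "\<dots> = (\<sigma> / real N * L2_unit_norm u)\<^sup>2"
      by (simp only: power_mult_distrib)
    finally have "L2_unit_norm (?L u) \<le> \<sigma> / real N * L2_unit_norm u"
      by (rule power2_le_imp_le) (use \<open>0 \<le> \<sigma>\<close> in \<open>simp add: L2_unit_norm_nonneg\<close>)
    also have "\<dots> \<le> \<sigma> / real N * 1"
      using u1 \<open>0 \<le> \<sigma>\<close> by (intro mult_left_mono) auto
    finally show "L2_unit_norm (?L u) \<le> \<sigma> / real N"
      by simp
  qed
  moreover have "\<sigma> / real N \<le> ?op"
    using \<sigma>(1) N by (simp add: field_simps)
  ultimately show ?thesis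
    by (simp add: \<sigma>_def)
qed

end

theorem proposition1:
  shows "((\<forall>h\<in>graphons. bounded_operator_L2 (laplacian_op h)) \<and>
          lower_semicontinuous_wrt cut_metric graphons (\<lambda>h. opnorm_L2 (laplacian_op h))) \<and>
         (\<forall>N E. N \<ge> 1 \<and> simple_graph N E \<longrightarrow>
            spectral_norm (laplacian_matrix N E) / real N =
            opnorm_L2 (laplacian_op (empirical_graphon N E)))"
proof (intro conjI ballI allI impI)
  fix h assume "h \<in> graphons"
  then show "bounded_operator_L2 (laplacian_op h)"
    by (metis graphon_kernel_representative kernel_representative.bounded_operator_laplacian)
next
  show "lower_semicontinuous_wrt cut_metric graphons (\<lambda>h. opnorm_L2 (laplacian_op h))"
    by (rule lower_semicontinuous_opnorm_laplacian)
next
  fix N E assume "N \<ge> 1 \<and> simple_graph N E"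
  then show "spectral_norm (laplacian_matrix N E) / real N = opnorm_L2 (laplacian_op (empirical_graphon N E))"
    using spectral_norm_laplacian_matrix by blast
qed

end
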